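(* For all $\tau_1,\tau_2\in(0,1)$ with $\tau_1+\tau_1\tau_2<1$ and (Lebesgue-)almost all $\beta_1,\beta_2\in(0,0.739)$ with $\beta_1+\beta_1\beta_2>1$, the Hausdorff dimension $d$ of the set \[ \Lambda=(\pi_{\beta_1,\beta_2}\times\pi_{\tau_1,\tau_2})(\Sigma_A)\subseteq\mathbb{R}^2 \] is given by the unique solution $d>1$ of \[ \beta_1\tau_1^{d-1}+\beta_1\beta_2(\tau_1\tau_2)^{d-1}=1. \]
   Context: $\Sigma_A\subseteq\{0,1\}^{\mathbb{N}}$ is the Fibonacci subshift: the set of sequences $(s_k)_{k\ge1}$ in $\{0,1\}$ with no two consecutive entries both equal to $1$. For $(s_k)\in\Sigma_A$ put $\sharp_i((s_k))=\sum_{k=1}^{i}s_k$. For $a,b\in(0,1)$ the coding map $\pi_{a,b}:\Sigma_A\to\mathbb{R}$ is \[ \pi_{a,b}((s_k))=\sum_{i=1}^{\infty}s_i\,b^{\sharp_i((s_k))}a^{\,i-\sharp_i((s_k))}. \] The map $\pi_{a,b}\times\pi_{a',b'}:\Sigma_A\to\mathbb{R}^2$ is $(s_k)\mapsto(\pi_{a,b}((s_k)),\pi_{a',b'}((s_k)))$. "Almost all $\beta_1,\beta_2$" refers to two-dimensional Lebesgue measure on pairs $(\beta_1,\beta_2)$, for each given pair $(\tau_1,\tau_2)$. *)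

theory Defs
  imports "HOL-Analysis.Analysis"
begin

section \<open>The Fibonacci subshift and its coding maps\<close>

text \<open>
  Sequences are indexed from 0 here: \<open>s n\<close> is the entry written \<open>s_(n+1)\<close> in the usual
  indexing by the positive integers.
\<close>

definition fibonacci_subshift :: "(nat \<Rightarrow> nat) set" where
  "fibonacci_subshift =
     {s. (\<forall>n. s n \<in> {0, 1}) \<and> (\<forall>n. \<not> (s n = 1 \<and> s (Suc n) = 1))}"

text \<open>The sum of the first \<open>i\<close> entries.\<close>

definition count_ones :: "nat \<Rightarrow> (nat \<Rightarrow> nat) \<Rightarrow> nat" where
  "count_ones i s = (\<Sum>k<i. s k)"

text \<open>
  The summand at \<open>n\<close> is the one with the positive index \<open>i = n + 1\<close>. The subtraction does not
  truncate on the subshift, because there \<open>count_ones i s \<le> i\<close>.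
\<close>

definition coding_map :: "real \<Rightarrow> real \<Rightarrow> (nat \<Rightarrow> nat) \<Rightarrow> real" where
  "coding_map a b s =
     (\<Sum>n. real (s n) * b ^ count_ones (Suc n) s * a ^ (Suc n - count_ones (Suc n) s))"

section \<open>Hausdorff measure and Hausdorff dimension\<close>

text \<open>
  The contribution \<open>(diam U)^t\<close> of a covering set, with the conventions that the empty set
  contributes 0 for every \<open>t\<close> and that \<open>0^0 = 1\<close> for a nonempty set (whereas
  \<open>0 powr 0 = 0\<close> in HOL), so that the 0-dimensional measure is counting measure.
\<close>

definition diam_powr :: "real \<Rightarrow> 'a::metric_space set \<Rightarrow> real" where
  "diam_powr t U = (if U = {} then 0 else if t = 0 then 1 else diameter U powr t)"

text \<open>
  Countable covers are sequences of sets, finite ones being padded with empty sets. Boundedness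
  is required explicitly because \<open>diameter\<close> is only meaningful for bounded sets.
\<close>

definition hausdorff_content :: "real \<Rightarrow> real \<Rightarrow> 'a::metric_space set \<Rightarrow> ennreal" where
  "hausdorff_content t \<delta> E =
     (INF U \<in> {U :: nat \<Rightarrow> 'a set. E \<subseteq> (\<Union>n. U n) \<and> (\<forall>n. bounded (U n) \<and> diameter (U n) \<le> \<delta>)}.
        (\<Sum>n. ennreal (diam_powr t (U n))))"

definition hausdorff_measure :: "real \<Rightarrow> 'a::metric_space set \<Rightarrow> ennreal" where
  "hausdorff_measure t E = (SUP \<delta>\<in>{0<..}. hausdorff_content t \<delta> E)"

definition hausdorff_dim :: "'a::metric_space set \<Rightarrow> ereal" where
  "hausdorff_dim E = Inf (ereal ` {t. 0 \<le> t \<and> hausdorff_measure t E = 0})"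

end

theory Submission
  imports Defs "HOL-Real_Asymp.Real_Asymp"
begin

text \<open>
  Cutting a sequence of the Fibonacci subshift into the blocks \<open>0\<close> and \<open>10\<close> identifies the subshift
  with the full shift on two symbols, and turns \<open>\<Lambda>\<close> into the attractor of the two affine maps
  \<open>(x, y) \<mapsto> (\<beta>1 x, \<tau>1 y)\<close> and \<open>(x, y) \<mapsto> (\<beta>2 + \<beta>1 \<beta>2 x, \<tau>2 + \<tau>1 \<tau>2 y)\<close>. For a finite word \<open>w\<close> over the two
  symbols write \<open>\<beta>_w\<close>, \<open>\<tau>_w\<close> for the products of the contraction ratios, and let
  \<open>\<phi>(t) = \<beta>1 \<tau>1^(t-1) + \<beta>1 \<beta>2 (\<tau>1 \<tau>2)^(t-1)\<close>, so that the sum of \<open>\<beta>_w \<tau>_w^(t-1)\<close> over the words of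
  length \<open>n\<close> is \<open>\<phi>(t)^n\<close>. The function \<open>\<phi>\<close> decreases strictly from \<open>\<phi>(1) > 1\<close> to 0, whence \<open>d\<close>.

  Upper bound, for \<open>t > d\<close>. The cylinder of \<open>w\<close> is covered by at most \<open>A \<beta>_w / \<tau>_w + 1\<close> sets of diameter
  at most a constant times \<open>\<tau>_w\<close>. Over all words of length \<open>n\<close> the \<open>t\<close>-th powers of the diameters sum to
  at most a constant times \<open>\<phi>(t)^n + (\<tau>1^t + (\<tau>1 \<tau>2)^t)^n\<close>, which tends to 0
  (\<open>hausdorff_measure_attractor_eq_0\<close>).

  Lower bound, for \<open>1 < t < d\<close>. Fix \<open>b1 < \<beta>1\<close> and \<open>b2 < \<beta>2\<close> for which the value \<open>S\<close> of \<open>\<phi>(t)\<close> at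
  \<open>(b1, b2)\<close> still exceeds 1, and give the word \<open>w\<close> the probability \<open>p_w = b_w \<tau>_w^(t-1) / S^|w|\<close>.
  Consider the \<open>t\<close>-energies of the measures that carry the mass \<open>p_w\<close> at the point of \<open>\<Lambda>\<close> coded by
  \<open>w\<close>, where \<open>w\<close> runs through the words of length \<open>n\<close>. Two words whose longest common prefix is \<open>v\<close> have
  points that are at least a constant times \<open>\<tau>_v\<close> apart in the second coordinate, because
  \<open>\<tau>1 + \<tau>1 \<tau>2 < 1\<close>. In the first coordinate they are \<open>\<beta>_v |\<Delta>(\<beta>1, \<beta>2)|\<close> apart, where \<open>\<Delta>\<close> satisfies a
  transversality condition in \<open>\<beta>2\<close> (\<open>cyl_point_transversal\<close>). Integrating over the parameters
  \<open>\<beta>1 \<ge> b1\<close>, \<open>\<beta>2 \<ge> b2\<close> therefore bounds the contribution of the pair by a constant times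
  \<open>p_w p_w' \<tau>_v^(1-t) / b_v\<close>. Pairs with common prefix \<open>v\<close> contribute at most a constant times
  \<open>p_v S^(-|v|)\<close> together, which is summable over all \<open>v\<close>; so the integrated energies are bounded
  uniformly in \<open>n\<close> (\<open>nn_integral_energy\<close>). By Fatou's lemma, for almost all parameters infinitely many of
  the energies lie below a bound that may depend on the parameters, and then a discrete form of
  Frostman's energy criterion
  (\<open>hausdorff_measure_pos_of_discrete_energy\<close>) gives positive \<open>t\<close>-dimensional measure. Rational
  \<open>t\<close>, \<open>b1\<close>, \<open>b2\<close> suffice, so only countably many null sets are discarded.

  Transversality holds because, with \<open>x = \<beta>1\<close> fixed and \<open>z = \<beta>1 \<beta>2\<close>, the polynomial
  \<open>F = \<Delta> / \<beta>2\<close> in \<open>z\<close> becomes strictly decreasing after multiplication by \<open>(1 - z) / z\<close>. Its rate of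
  decrease is at least \<open>(1 - x) / z^2 - 2 x q\<close> for \<open>z \<le> q = 0.5462\<close>, and this is positive since
  \<open>x \<le> 0.739\<close> and \<open>0.739^2 < q\<close>.
\<close>

section \<open>Words over two symbols\<close>

text \<open>
  The words of length \<open>n\<close>. The letter \<open>False\<close> stands for the block \<open>0\<close> of the subshift and \<open>True\<close> for the
  block \<open>10\<close>.
\<close>

definition words :: "nat \<Rightarrow> bool list set" where
  "words n = {w. length w = n}"

lemma words_0 [simp]: "words 0 = {[]}"
  by (auto simp: words_def)

lemma words_Suc: "words (Suc n) = Cons False ` words n \<union> Cons True ` words n"
proof -
  have "w \<in> Cons False ` words n \<union> Cons True ` words n" if "length w = Suc n" for w
    using that by (cases w; cases "hd w") (auto simp: words_def)
  then show ?thesis by (auto simp: words_def)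
qed

lemma finite_words [simp]: "finite (words n)"
  by (induction n) (auto simp: words_Suc)

lemma sum_words_Suc:
  fixes f :: "bool list \<Rightarrow> 'a::comm_monoid_add"
  shows "(\<Sum>w\<in>words (Suc n). f w) =
    (\<Sum>w\<in>words n. f (False # w)) + (\<Sum>w\<in>words n. f (True # w))"
  unfolding words_Suc
  by (subst sum.union_disjoint) (auto simp: sum.reindex)

text \<open>
  The product over a word of the weights \<open>a\<close> for \<open>False\<close> and \<open>c\<close> for \<open>True\<close>. It serves for contraction
  ratios as well as for probabilities.
\<close>

fun wprod :: "real \<Rightarrow> real \<Rightarrow> bool list \<Rightarrow> real" where
  "wprod a c [] = 1"
| "wprod a c (i # w) = (if i then c else a) * wprod a c w"

lemma wprod_append: "wprod a c (v @ w) = wprod a c v * wprod a c w"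
  by (induction v) auto

lemma wprod_pos: "0 < a \<Longrightarrow> 0 < c \<Longrightarrow> 0 < wprod a c w"
  by (induction w) auto

lemma wprod_mult: "wprod a c w * wprod a' c' w = wprod (a * a') (c * c') w"
  by (induction w) (auto simp: algebra_simps)

lemma wprod_powr:
  assumes "0 < a" "0 < c"
  shows "wprod a c w powr s = wprod (a powr s) (c powr s) w"
  using assms wprod_pos[OF assms]
  by (induction w) (auto simp: powr_mult less_imp_le)

lemma wprod_mono:
  assumes "0 \<le> a" "0 \<le> c" "a \<le> a'" "c \<le> c'"
  shows "0 \<le> wprod a c w \<and> wprod a c w \<le> wprod a' c' w"
  using assms by (induction w) (auto intro!: mult_mono intro: order_trans)

lemma wprod_const: "wprod r r w = r ^ length w"
  by (induction w) auto

lemma sum_words_wprod: "(\<Sum>w\<in>words n. wprod a c w) = (a + c) ^ n"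
  by (induction n) (auto simp: sum_words_Suc sum_distrib_left[symmetric] algebra_simps)

text \<open>
  The image of 0 under the composition along a word of the maps \<open>x \<mapsto> a x\<close> (for \<open>False\<close>) and
  \<open>x \<mapsto> b + a b x\<close> (for \<open>True\<close>); it is the value of the coding map at the word's blocks followed by
  zeros.
\<close>

fun cyl_point :: "real \<Rightarrow> real \<Rightarrow> bool list \<Rightarrow> real" where
  "cyl_point a b [] = 0"
| "cyl_point a b (i # w) = (if i then b + a * b * cyl_point a b w else a * cyl_point a b w)"

lemma cyl_point_append:
  "cyl_point a b (v @ w) = cyl_point a b v + wprod a (a * b) v * cyl_point a b w"
  by (induction v) (auto simp: algebra_simps)

lemma cyl_point_bounds:
  assumes "0 < a" "a < 1" "0 < b" "b < 1"
  shows "0 \<le> cyl_point a b w \<and> cyl_point a b w \<le> b / (1 - a * b)"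
proof (induction w)
  case Nil
  have "a * b < 1" using assms mult_strict_mono[of a 1 b 1] by simp
  then show ?case using assms by simp
next
  case (Cons i w)
  let ?M = "b / (1 - a * b)"
  have ab: "a * b < 1" using assms mult_strict_mono[of a 1 b 1] by simp
  have M: "0 \<le> ?M" "b + a * b * ?M = ?M" using ab assms by (auto simp: field_simps)
  have "a * b * cyl_point a b w \<le> a * b * ?M"
    using Cons assms by (intro mult_left_mono) auto
  moreover have "a * cyl_point a b w \<le> 1 * ?M"
    using Cons assms M by (intro mult_mono) auto
  ultimately show ?case using M(2) Cons assms by auto
qed

text \<open>
  The two first-level cylinders lie in \<open>[0, a M]\<close> and \<open>[b, M]\<close> with \<open>M = b / (1 - a b)\<close>. These intervals
  are disjoint as soon as \<open>a + a b < 1\<close>.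
\<close>

lemma cyl_point_separated:
  assumes "0 < a" "a < 1" "0 < b" "b < 1"
  shows "b - a * (b / (1 - a * b)) \<le> cyl_point a b (True # u) - cyl_point a b (False # v)"
proof -
  have "a * cyl_point a b v \<le> a * (b / (1 - a * b))"
    using cyl_point_bounds[OF assms, of v] assms by (intro mult_left_mono) auto
  moreover have "0 \<le> a * b * cyl_point a b u"
    using cyl_point_bounds[OF assms, of u] assms by simp
  ultimately show ?thesis by simp
qed

lemma separation_constant_pos:
  fixes a b :: real
  assumes "0 < a" "a < 1" "0 < b" "b < 1" "a + a * b < 1"
  shows "0 < b - a * (b / (1 - a * b))"
proof -
  have ab: "0 < 1 - a * b" using assms by simp
  have "b - a * (b / (1 - a * b)) = b * (1 - a * b - a) / (1 - a * b)"
    using ab by (simp add: field_simps)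
  also have "\<dots> > 0" using ab assms by simp
  finally show ?thesis .
qed

section \<open>Transversality in the second parameter\<close>

text \<open>
  With \<open>z = a b\<close> and \<open>F = cyl_point a b w / b\<close>, this is the polynomial \<open>1 - (1 - z) F\<close> in \<open>z\<close>, for
  \<open>x = a\<close>. If \<open>x\<close> lies between 0 and 1, it has nonnegative coefficients with sum at most 1.
\<close>

fun defect_poly :: "real \<Rightarrow> bool list \<Rightarrow> real \<Rightarrow> real" where
  "defect_poly x [] z = 1"
| "defect_poly x (i # w) z = (if i then z * defect_poly x w z else 1 - x + x * defect_poly x w z)"

lemma cyl_point_defect_poly:
  "(1 - a * b) * cyl_point a b w = b * (1 - defect_poly a w (a * b))"
proof (induction w)
  case (Cons i w)
  then show ?case
    by (cases i) (simp_all add: algebra_simps, algebra+)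
qed simp

lemma defect_poly_mono:
  assumes "0 \<le> x" "x \<le> 1" "0 \<le> z1" "z1 \<le> z2"
  shows "0 \<le> defect_poly x w z1 \<and> defect_poly x w z1 \<le> defect_poly x w z2"
  using assms by (induction w) (auto intro!: mult_mono mult_left_mono)

text \<open>
  On the interval up to 0.5462 no derivative \<open>k z^(k-1)\<close> exceeds \<open>1.0924 = 2 * 0.5462\<close>, the value for
  \<open>k = 2\<close> at the right end.
\<close>

lemma power_diff_Lipschitz:
  fixes z1 z2 :: real
  assumes "0 \<le> z1" "z1 \<le> z2" "z2 \<le> 0.5462"
  shows "z2 ^ k - z1 ^ k \<le> 1.0924 * (z2 - z1)"
proof (induction k)
  case 0
  then show ?case using assms by simp
next
  case (Suc k)
  consider "k = 0" | "k = 1" | "2 \<le> k" by linarith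
  then show ?case
  proof cases
    case 1
    then show ?thesis using assms by simp
  next
    case 2
    have "z2 ^ 2 - z1 ^ 2 = (z2 + z1) * (z2 - z1)" by (simp add: power2_eq_square algebra_simps)
    also have "\<dots> \<le> 1.0924 * (z2 - z1)" using assms by (intro mult_right_mono) auto
    finally show ?thesis using 2 by (simp add: numeral_2_eq_2)
  next
    case 3
    have "z1 ^ k \<le> z1 ^ 2" using assms 3 by (intro power_decreasing) auto
    also have "\<dots> \<le> 0.5462 ^ 2" using assms by (intro power_mono) auto
    finally have z1k: "z1 ^ k \<le> 0.2984" by (simp add: power2_eq_square)
    have "z2 ^ Suc k - z1 ^ Suc k = z2 * (z2 ^ k - z1 ^ k) + z1 ^ k * (z2 - z1)"
      by (simp add: algebra_simps)
    also have "\<dots> \<le> z2 * (1.0924 * (z2 - z1)) + 0.2984 * (z2 - z1)"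
      using Suc z1k assms by (intro add_mono mult_left_mono mult_right_mono) auto
    also have "\<dots> \<le> 0.5462 * (1.0924 * (z2 - z1)) + 0.2984 * (z2 - z1)"
      using assms by (intro add_mono mult_right_mono) auto
    also have "\<dots> = 0.89506888 * (z2 - z1)" by (simp add: field_simps)
    also have "\<dots> \<le> 1.0924 * (z2 - z1)" using assms by (intro mult_right_mono) auto
    finally show ?thesis .
  qed
qed

text \<open>
  The extra factor \<open>z^k\<close> makes the induction go through, since \<open>True\<close> multiplies the polynomial by \<open>z\<close>.
\<close>

lemma defect_poly_Lipschitz:
  assumes "0 \<le> x" "x \<le> 1" "0 \<le> z1" "z1 \<le> z2" "z2 \<le> 0.5462"
  shows "z2 ^ k * defect_poly x w z2 - z1 ^ k * defect_poly x w z1 \<le> 1.0924 * (z2 - z1)"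
proof (induction w arbitrary: k)
  case Nil
  then show ?case using power_diff_Lipschitz[of z1 z2 k] assms by simp
next
  case (Cons i w)
  show ?case
  proof (cases i)
    case True
    then show ?thesis using Cons[of "Suc k"] by (simp add: algebra_simps)
  next
    case False
    have "z2 ^ k * defect_poly x (i # w) z2 - z1 ^ k * defect_poly x (i # w) z1 =
       (1 - x) * (z2 ^ k - z1 ^ k) + x * (z2 ^ k * defect_poly x w z2 - z1 ^ k * defect_poly x w z1)"
      using False by (simp add: algebra_simps)
    also have "\<dots> \<le> (1 - x) * (1.0924 * (z2 - z1)) + x * (1.0924 * (z2 - z1))"
      using assms Cons[of k] power_diff_Lipschitz[of z1 z2 k]
      by (intro add_mono mult_left_mono) auto
    also have "\<dots> = 1.0924 * (z2 - z1)" by algebra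
    finally show ?thesis .
  qed
qed

text \<open>
  Only an upper bound for the increase is claimed: the constant coefficient contributes a multiple of
  \<open>1 / z\<close>, which is decreasing.
\<close>

lemma defect_poly_div_Lipschitz:
  assumes "0 \<le> x" "x \<le> 1" "0 < z1" "z1 \<le> z2" "z2 \<le> 0.5462"
  shows "defect_poly x w z2 / z2 - defect_poly x w z1 / z1 \<le> 1.0924 * (z2 - z1)"
proof (induction w)
  case Nil
  have "1 / z2 \<le> 1 / z1" using assms by (intro divide_left_mono) auto
  moreover have "0 \<le> z2 - z1" using assms by simp
  ultimately show ?case by simp
next
  case (Cons i w)
  show ?case
  proof (cases i)
    case True
    then show ?thesis using defect_poly_Lipschitz[of x z1 z2 0 w] assms by simp
  next
    case False
    have inv: "1 / z2 \<le> 1 / z1" using assms by (intro divide_left_mono) auto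
    have "defect_poly x (i # w) z2 / z2 - defect_poly x (i # w) z1 / z1 =
       (1 - x) * (1 / z2 - 1 / z1) + x * (defect_poly x w z2 / z2 - defect_poly x w z1 / z1)"
      using False assms by (simp add: field_simps)
    also have "\<dots> \<le> (1 - x) * 0 + 1 * (1.0924 * (z2 - z1))"
    proof (rule add_mono)
      show "(1 - x) * (1 / z2 - 1 / z1) \<le> (1 - x) * 0"
        using inv assms by (intro mult_left_mono) auto
      have "x * (defect_poly x w z2 / z2 - defect_poly x w z1 / z1) \<le> x * (1.0924 * (z2 - z1))"
        using Cons assms by (intro mult_left_mono) auto
      also have "\<dots> \<le> 1 * (1.0924 * (z2 - z1))"
        using assms by (intro mult_right_mono) auto
      finally show "x * (defect_poly x w z2 / z2 - defect_poly x w z1 / z1) \<le> 1 * (1.0924 * (z2 - z1))" .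
    qed
    finally show ?thesis by simp
  qed
qed

text \<open>
  For \<open>x = \<beta>1\<close> and \<open>z = \<beta>1 \<beta>2\<close> this is \<open>(1 - z) / z\<close> times the difference of the points of the words
  \<open>True # u\<close> and \<open>False # v\<close>, divided by \<open>\<beta>2\<close>.
\<close>

definition gap_fun :: "real \<Rightarrow> bool list \<Rightarrow> bool list \<Rightarrow> real \<Rightarrow> real" where
  "gap_fun x u v z = (1 - x) / z - defect_poly x u z + x * (defect_poly x v z / z)"

lemma cyl_point_diff_gap_fun:
  assumes "0 < a" "0 < b" "a * b < 1"
  shows "cyl_point a b (True # u) - cyl_point a b (False # v) =
    a * b\<^sup>2 / (1 - a * b) * gap_fun a u v (a * b)"
proof -
  have "(1 - a * b) * (cyl_point a b (True # u) - cyl_point a b (False # v)) =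
      b * (defect_poly a (False # v) (a * b) - defect_poly a (True # u) (a * b))"
    by (simp only: cyl_point_defect_poly right_diff_distrib)
  also have "\<dots> = a * b\<^sup>2 * gap_fun a u v (a * b)"
    using assms by (simp add: gap_fun_def field_simps power2_eq_square)
  finally show ?thesis using assms by (simp add: field_simps)
qed

text \<open>
  The term \<open>(1 - x) / z\<close> decreases at rate at least \<open>0.261 / 0.5462^2 > 0.874\<close>, the second term
  decreases, and the third increases at rate at most \<open>0.739 * 1.0924 < 0.81\<close>.
\<close>

lemma gap_fun_transversal:
  assumes "0 \<le> x" "x \<le> 0.739" "0 < z1" "z1 \<le> z2" "z2 \<le> 0.5462"
  shows "0.06 * (z2 - z1) \<le> gap_fun x u v z1 - gap_fun x u v z2"
proof -
  have "z1 * z2 \<le> 0.5462 * 0.5462" using assms by (intro mult_mono) auto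
  then have "0.261 / (0.5462 * 0.5462) \<le> (1 - x) / (z1 * z2)"
    using assms by (intro frac_le) auto
  moreover have "(0.874::real) \<le> 0.261 / (0.5462 * 0.5462)" by simp
  ultimately have "0.874 \<le> (1 - x) / (z1 * z2)" by (rule order_trans[rotated])
  then have "0.874 * (z2 - z1) \<le> (1 - x) / (z1 * z2) * (z2 - z1)"
    using assms by (intro mult_right_mono) auto
  also have "\<dots> = (1 - x) / z1 - (1 - x) / z2"
    using assms by (simp add: field_simps)
  finally have 1: "0.874 * (z2 - z1) \<le> (1 - x) / z1 - (1 - x) / z2" .
  have 2: "defect_poly x u z1 \<le> defect_poly x u z2"
    using defect_poly_mono assms by auto
  have "x * (defect_poly x v z2 / z2 - defect_poly x v z1 / z1) \<le> x * (1.0924 * (z2 - z1))"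
    using assms by (intro mult_left_mono defect_poly_div_Lipschitz) auto
  also have "\<dots> \<le> 0.739 * (1.0924 * (z2 - z1))"
    using assms by (intro mult_right_mono) auto
  also have "\<dots> = 0.8072836 * (z2 - z1)" by (simp add: field_simps)
  also have "\<dots> \<le> 0.81 * (z2 - z1)" using assms by (intro mult_right_mono) auto
  finally have "x * (defect_poly x v z2 / z2) - x * (defect_poly x v z1 / z1) \<le> 0.81 * (z2 - z1)"
    by (simp only: right_diff_distrib)
  then have "0.874 * (z2 - z1) + 0 - 0.81 * (z2 - z1) \<le> ((1 - x) / z1 - (1 - x) / z2) +
      (defect_poly x u z2 - defect_poly x u z1) - (x * (defect_poly x v z2 / z2) - x * (defect_poly x v z1 / z1))"
    using 1 2 by (intro diff_mono add_mono) auto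
  also have "\<dots> = gap_fun x u v z1 - gap_fun x u v z2"
    unfolding gap_fun_def by (simp only: algebra_simps)
  finally have "0.874 * (z2 - z1) - 0.81 * (z2 - z1) \<le> gap_fun x u v z1 - gap_fun x u v z2"
    by simp
  moreover have "0.06 * D \<le> 0.874 * D - 0.81 * D" if "0 \<le> D" for D :: real
    using that by simp
  then have "0.06 * (z2 - z1) \<le> 0.874 * (z2 - z1) - 0.81 * (z2 - z1)" using assms by (metis diff_ge_0_iff_ge)
  ultimately show ?thesis by (rule order_trans[rotated])
qed

lemma continuous_on_gap_fun:
  assumes "0 \<notin> S"
  shows "continuous_on S (gap_fun x u v)"
proof -
  have "continuous_on S (defect_poly x w)" for w
  proof (induction w)
    case (Cons i w)
    then show ?case by (cases i) (auto intro!: continuous_intros)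
  qed (simp)
  then show ?thesis unfolding gap_fun_def
    using assms by (auto intro!: continuous_intros)
qed

text \<open>
  For fixed \<open>\<beta>1 = a\<close>, the difference of the points of two words with different first letters is
  bounded below by a multiple of the distance of \<open>\<beta>2\<close> to one point \<open>s0\<close>. This is the zero of
  \<^const>\<open>gap_fun\<close>, as a function of \<open>\<beta>2\<close>, if there is one, and otherwise the end of the interval at
  which that function is closest to 0.
\<close>

lemma cyl_point_transversal:
  assumes "0 < b1" "b1 \<le> a" "a \<le> 0.739" "0 < b2" "b2 \<le> 0.739"
  obtains s0 where "\<And>s. s \<in> {b2..0.739} \<Longrightarrow>
     0.06 * b1\<^sup>2 * b2\<^sup>2 * \<bar>s - s0\<bar> \<le> \<bar>cyl_point a s (True # u) - cyl_point a s (False # v)\<bar>"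
proof -
  define g where "g s = gap_fun a u v (a * s)" for s
  have as: "a * s \<le> 0.5462" if "s \<in> {b2..0.739}" for s
  proof -
    have "a * s \<le> 0.739 * 0.739" using that assms by (intro mult_mono) auto
    then show ?thesis by simp
  qed
  have g_diff: "0.06 * b1 * (s' - s) \<le> g s - g s'"
    if "s \<in> {b2..0.739}" "s' \<in> {b2..0.739}" "s \<le> s'" for s s'
  proof -
    have "0.06 * b1 * (s' - s) \<le> 0.06 * a * (s' - s)"
      using assms that by (intro mult_right_mono) auto
    also have "\<dots> = 0.06 * (a * s' - a * s)" by (simp add: algebra_simps)
    also have "\<dots> \<le> g s - g s'" unfolding g_def
      using that assms as[OF that(2)] by (intro gap_fun_transversal) (auto intro: mult_left_mono)
    finally show ?thesis .
  qed
  have cont: "continuous_on {b2..0.739} g"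
    unfolding g_def
  proof (rule continuous_on_compose2[OF continuous_on_gap_fun])
    show "(*) a ` {b2..0.739} \<subseteq> {0<..}" using assms
      by (auto simp del: image_mult_atLeastAtMost intro!: mult_pos_pos)
  qed (auto intro!: continuous_on_mult_left continuous_on_id)
  have "\<exists>s0. \<forall>s\<in>{b2..0.739}. 0.06 * b1 * \<bar>s - s0\<bar> \<le> \<bar>g s\<bar>"
  proof (cases "g b2 < 0 \<or> 0 < g 0.739")
    case True
    then show ?thesis
    proof
      assume neg: "g b2 < 0"
      have "0.06 * b1 * \<bar>s - b2\<bar> \<le> \<bar>g s\<bar>" if "s \<in> {b2..0.739}" for s
        using g_diff[of b2 s] neg that assms by auto
      then show ?thesis by blast
    next
      assume pos: "0 < g 0.739"
      have "0.06 * b1 * \<bar>s - 0.739\<bar> \<le> \<bar>g s\<bar>" if "s \<in> {b2..0.739}" for s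
        using g_diff[of s "0.739"] pos that assms by auto
      then show ?thesis by blast
    qed
  next
    case False
    then obtain s0 where s0: "b2 \<le> s0" "s0 \<le> 0.739" "g s0 = 0"
      using IVT2'[of g "0.739" 0 b2] cont assms by auto
    have "0.06 * b1 * \<bar>s - s0\<bar> \<le> \<bar>g s\<bar>" if "s \<in> {b2..0.739}" for s
      using g_diff[of s s0] g_diff[of s0 s] s0 that by (cases "s \<le> s0") auto
    then show ?thesis by blast
  qed
  then obtain s0 where s0: "\<And>s. s \<in> {b2..0.739} \<Longrightarrow> 0.06 * b1 * \<bar>s - s0\<bar> \<le> \<bar>g s\<bar>" by blast
  show thesis
  proof (rule that)
    fix s assume s: "s \<in> {b2..0.739}"
    \<comment> \<open>the factor between \<open>g s\<close> and the difference of the points is bounded below\<close>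
    have as1: "a * s < 1" "0 \<le> a * s" using as[OF s] assms s by auto
    have "b1 * b2\<^sup>2 \<le> a * s\<^sup>2"
      using assms s by (intro mult_mono power_mono) auto
    also have "\<dots> \<le> a * s\<^sup>2 / (1 - a * s)"
      using as1 assms by (simp add: pos_le_divide_eq mult_left_le)
    finally have c: "b1 * b2\<^sup>2 \<le> a * s\<^sup>2 / (1 - a * s)" .
    have "0.06 * b1\<^sup>2 * b2\<^sup>2 * \<bar>s - s0\<bar> = b1 * b2\<^sup>2 * (0.06 * b1 * \<bar>s - s0\<bar>)"
      by (simp add: power2_eq_square algebra_simps)
    also have "\<dots> \<le> a * s\<^sup>2 / (1 - a * s) * \<bar>g s\<bar>"
      using s0[OF s] c assms by (intro mult_mono) (auto intro: order_trans[of _ "b1 * b2\<^sup>2"])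
    also have "\<dots> = \<bar>cyl_point a s (True # u) - cyl_point a s (False # v)\<bar>"
      using cyl_point_diff_gap_fun[of a s u v] as1 assms s
      by (simp add: g_def abs_mult del: cyl_point.simps)
    finally show "0.06 * b1\<^sup>2 * b2\<^sup>2 * \<bar>s - s0\<bar> \<le>
        \<bar>cyl_point a s (True # u) - cyl_point a s (False # v)\<bar>" .
  qed
qed

section \<open>Self-affine structure and compactness of the coded set\<close>

text \<open>
  The sequence with first entry \<open>x\<close> and remaining entries \<open>s\<close>.
\<close>

definition seq_cons :: "nat \<Rightarrow> (nat \<Rightarrow> nat) \<Rightarrow> nat \<Rightarrow> nat" where
  "seq_cons x s n = (case n of 0 \<Rightarrow> x | Suc k \<Rightarrow> s k)"

lemma seq_cons_simps [simp]: "seq_cons x s 0 = x" "seq_cons x s (Suc n) = s n"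
  by (simp_all add: seq_cons_def)

lemma fibonacci_subshift_cases:
  assumes "s \<in> fibonacci_subshift"
  obtains s' where "s' \<in> fibonacci_subshift" "s = seq_cons 0 s'"
    | s' where "s' \<in> fibonacci_subshift" "s = seq_cons 1 (seq_cons 0 s')"
proof -
  have s01: "s n = 0 \<or> s n = 1" for n
    using assms unfolding fibonacci_subshift_def by blast
  have no11: "s (Suc n) = 0" if "s n = 1" for n
    using assms s01[of "Suc n"] that unfolding fibonacci_subshift_def by blast
  have shift: "(\<lambda>n. s (n + k)) \<in> fibonacci_subshift" for k
    using assms unfolding fibonacci_subshift_def by (simp only: mem_Collect_eq add_Suc) blast
  show thesis
  proof (cases "s 0 = 0")
    case True
    then have "s = seq_cons 0 (\<lambda>n. s (n + 1))" by (intro ext) (simp add: seq_cons_def split: nat.split)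
    then show ?thesis by (rule that(1)[OF shift])
  next
    case False
    then have "s 0 = 1" "s (Suc 0) = 0" using s01[of 0] no11[of 0] by simp_all
    then have "s = seq_cons 1 (seq_cons 0 (\<lambda>n. s (n + 2)))"
      by (intro ext) (simp add: seq_cons_def split: nat.split)
    then show ?thesis by (rule that(2)[OF shift])
  qed
qed

lemma fibonacci_subshift_Cons0:
  assumes "s \<in> fibonacci_subshift"
  shows "seq_cons 0 s \<in> fibonacci_subshift"
proof -
  have "seq_cons 0 s n \<in> {0, 1}" and
    "\<not> (seq_cons 0 s n = 1 \<and> seq_cons 0 s (Suc n) = 1)" for n
    using assms by (cases n; force simp: fibonacci_subshift_def)+
  then show ?thesis unfolding fibonacci_subshift_def by blast
qed

lemma fibonacci_subshift_Cons10:
  assumes "s \<in> fibonacci_subshift"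
  shows "seq_cons 1 (seq_cons 0 s) \<in> fibonacci_subshift"
proof -
  let ?s = "seq_cons 0 s"
  have s: "?s \<in> fibonacci_subshift" by (rule fibonacci_subshift_Cons0) fact
  have "seq_cons 1 ?s n \<in> {0, 1}" and
    "\<not> (seq_cons 1 ?s n = 1 \<and> seq_cons 1 ?s (Suc n) = 1)" for n
    using s unfolding fibonacci_subshift_def by (cases n; simp)+
  then show ?thesis unfolding fibonacci_subshift_def by blast
qed

lemma count_ones_Cons: "count_ones (Suc n) (seq_cons x s) = x + count_ones n s"
  unfolding count_ones_def by (subst sum.lessThan_Suc_shift) simp

lemma count_ones_le:
  assumes "s \<in> fibonacci_subshift"
  shows "count_ones n s \<le> n"
proof -
  have "s k \<in> {0, 1}" for k using assms by (simp add: fibonacci_subshift_def)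
  then have "s k \<le> 1" for k by (metis insertE le_refl singletonD zero_le_one)
  then have "count_ones n s \<le> (\<Sum>k<n. 1)" unfolding count_ones_def by (intro sum_mono)
  then show ?thesis by simp
qed

text \<open>
  The summand of \<^const>\<open>coding_map\<close> at \<open>n\<close>.
\<close>

definition coding_term :: "real \<Rightarrow> real \<Rightarrow> (nat \<Rightarrow> nat) \<Rightarrow> nat \<Rightarrow> real" where
  "coding_term a b s n =
     real (s n) * b ^ count_ones (Suc n) s * a ^ (Suc n - count_ones (Suc n) s)"

lemma coding_term_bounds:
  assumes "0 < a" "a < 1" "0 < b" "b < 1" "s \<in> fibonacci_subshift"
  shows "0 \<le> coding_term a b s n" "coding_term a b s n \<le> max a b ^ n"
proof -
  let ?c = "count_ones (Suc n) s"
  have "?c \<le> Suc n" by (rule count_ones_le) fact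
  have s: "s n = 0 \<or> s n = 1" using assms by (auto simp: fibonacci_subshift_def)
  show "0 \<le> coding_term a b s n" using assms by (simp add: coding_term_def)
  have "coding_term a b s n \<le> 1 * max a b ^ ?c * max a b ^ (Suc n - ?c)"
    unfolding coding_term_def using assms s
    by (intro mult_mono power_mono) (auto simp: le_max_iff_disj)
  also have "\<dots> = max a b ^ Suc n"
    using \<open>?c \<le> Suc n\<close> by (simp add: power_add[symmetric] del: power_Suc)
  also have "\<dots> \<le> max a b ^ n" using assms by (intro power_decreasing) auto
  finally show "coding_term a b s n \<le> max a b ^ n" .
qed

lemma summable_coding_term:
  assumes "0 < a" "a < 1" "0 < b" "b < 1" "s \<in> fibonacci_subshift"
  shows "summable (coding_term a b s)"
proof (rule summable_comparison_test')
  show "summable (\<lambda>n. max a b ^ n)" using assms by (intro summable_geometric) auto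
  show "norm (coding_term a b s n) \<le> max a b ^ n" if "0 \<le> n" for n
    using coding_term_bounds[OF assms] by simp
qed

lemma coding_map_eq_suminf: "coding_map a b s = (\<Sum>n. coding_term a b s n)"
  by (simp add: coding_map_def coding_term_def)

lemma coding_map_bounds:
  assumes "0 < a" "a < 1" "0 < b" "b < 1" "s \<in> fibonacci_subshift"
  shows "coding_map a b s \<in> {0..1 / (1 - max a b)}"
proof -
  have "(\<Sum>n. coding_term a b s n) \<le> (\<Sum>n. max a b ^ n)"
    using assms coding_term_bounds[OF assms] summable_coding_term[OF assms]
    by (intro suminf_le summable_geometric) auto
  moreover have "\<dots> = 1 / (1 - max a b)" using assms by (intro suminf_geometric) auto
  moreover have "0 \<le> (\<Sum>n. coding_term a b s n)"
    using coding_term_bounds(1)[OF assms] summable_coding_term[OF assms] by (intro suminf_nonneg) auto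
  ultimately show ?thesis by (simp add: coding_map_eq_suminf)
qed

lemma coding_map_Cons0:
  assumes "0 < a" "a < 1" "0 < b" "b < 1" "s \<in> fibonacci_subshift"
  shows "coding_map a b (seq_cons 0 s) = a * coding_map a b s"
proof -
  have "coding_map a b (seq_cons 0 s) =
      coding_term a b (seq_cons 0 s) 0 + (\<Sum>n. coding_term a b (seq_cons 0 s) (Suc n))"
    unfolding coding_map_eq_suminf
    using suminf_split_head[OF summable_coding_term[OF assms(1-4) fibonacci_subshift_Cons0[OF assms(5)]]]
    by simp
  also have "(\<lambda>n. coding_term a b (seq_cons 0 s) (Suc n)) = (\<lambda>n. a * coding_term a b s n)"
  proof
    fix n
    show "coding_term a b (seq_cons 0 s) (Suc n) = a * coding_term a b s n"
      using count_ones_le[OF assms(5), of "Suc n"]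
      by (simp add: coding_term_def count_ones_Cons Suc_diff_le)
  qed
  also have "(\<Sum>n. a * coding_term a b s n) = a * coding_map a b s"
    using suminf_mult[OF summable_coding_term[OF assms], of a] by (simp add: coding_map_eq_suminf)
  also have "coding_term a b (seq_cons 0 s) 0 = 0" by (simp add: coding_term_def)
  finally show ?thesis by simp
qed

lemma coding_map_Cons10:
  assumes "0 < a" "a < 1" "0 < b" "b < 1" "s \<in> fibonacci_subshift"
  shows "coding_map a b (seq_cons 1 (seq_cons 0 s)) = b + a * b * coding_map a b s"
proof -
  let ?t = "seq_cons 0 s"
  have t: "?t \<in> fibonacci_subshift" using assms by (intro fibonacci_subshift_Cons0)
  have "coding_map a b (seq_cons 1 ?t) =
      coding_term a b (seq_cons 1 ?t) 0 + (\<Sum>n. coding_term a b (seq_cons 1 ?t) (Suc n))"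
    unfolding coding_map_eq_suminf
    using suminf_split_head[OF summable_coding_term[OF assms(1-4) fibonacci_subshift_Cons10[OF assms(5)]]]
    by simp
  also have "(\<lambda>n. coding_term a b (seq_cons 1 ?t) (Suc n)) = (\<lambda>n. b * coding_term a b ?t n)"
  proof
    fix n
    have "coding_term a b (seq_cons 1 ?t) (Suc n) = real (?t n) * b ^ (1 + count_ones (Suc n) ?t) *
        a ^ (Suc (Suc n) - (1 + count_ones (Suc n) ?t))"
      unfolding coding_term_def count_ones_Cons by simp
    also have "\<dots> = b * coding_term a b ?t n" by (simp add: coding_term_def)
    finally show "coding_term a b (seq_cons 1 ?t) (Suc n) = b * coding_term a b ?t n" .
  qed
  also have "(\<Sum>n. b * coding_term a b ?t n) = b * coding_map a b ?t"
    using suminf_mult[OF summable_coding_term[OF assms(1-4) t], of b]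
    by (simp add: coding_map_eq_suminf)
  also have "coding_term a b (seq_cons 1 ?t) 0 = b"
    by (simp add: coding_term_def count_ones_def)
  finally show ?thesis using coding_map_Cons0[OF assms] by simp
qed

text \<open>
  The image of the subshift under the pair of the coding maps with parameters \<open>(a, b)\<close> and \<open>(c, d)\<close>.
\<close>

definition attractor :: "real \<Rightarrow> real \<Rightarrow> real \<Rightarrow> real \<Rightarrow> (real \<times> real) set" where
  "attractor a b c d = (\<lambda>s. (coding_map a b s, coding_map c d s)) ` fibonacci_subshift"

text \<open>
  Compactness refers to the product topology on sequences of natural numbers: by Tychonoff's theorem
  the sequences with entries 0 and 1 form a compact set, of which the subshift is a closed subset.
\<close>

lemma compact_fibonacci_subshift: "compact fibonacci_subshift"
proof -
  have "compactin (product_topology (\<lambda>_. euclidean) UNIV) (PiE UNIV (\<lambda>_::nat. {0, 1 :: nat}))"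
    by (subst compactin_PiE) auto
  then have "compact (PiE UNIV (\<lambda>_::nat. {0, 1 :: nat}))"
    by (simp add: euclidean_product_topology)
  moreover have "closed {s :: nat \<Rightarrow> nat. \<forall>n. \<not> (s n = 1 \<and> s (Suc n) = 1)}"
  proof -
    have "closed {s :: nat \<Rightarrow> nat. \<not> (s n = 1 \<and> s (Suc n) = 1)}" for n
    proof -
      have "open ((\<lambda>s :: nat \<Rightarrow> nat. s k) -` {1})" for k
        by (rule open_vimage) (auto intro: open_discrete)
      then have "open ((\<lambda>s :: nat \<Rightarrow> nat. s n) -` {1} \<inter> (\<lambda>s. s (Suc n)) -` {1})"
        by (intro open_Int)
      moreover have "(\<lambda>s :: nat \<Rightarrow> nat. s n) -` {1} \<inter> (\<lambda>s. s (Suc n)) -` {1} =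
          - {s. \<not> (s n = 1 \<and> s (Suc n) = 1)}" by auto
      ultimately show ?thesis by (simp add: closed_def)
    qed
    then show ?thesis by (rule closed_Collect_all)
  qed
  ultimately have "compact (PiE UNIV (\<lambda>_::nat. {0, 1 :: nat}) \<inter>
      {s. \<forall>n. \<not> (s n = 1 \<and> s (Suc n) = 1)})"
    by (rule compact_Int_closed)
  also have "PiE UNIV (\<lambda>_::nat. {0, 1 :: nat}) \<inter> {s. \<forall>n. \<not> (s n = 1 \<and> s (Suc n) = 1)} =
      fibonacci_subshift"
    unfolding fibonacci_subshift_def PiE_UNIV_domain by blast
  finally show ?thesis .
qed

lemma continuous_on_coding_map:
  assumes "0 < a" "a < 1" "0 < b" "b < 1"
  shows "continuous_on fibonacci_subshift (coding_map a b)"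
proof -
  have term_cont: "continuous_on fibonacci_subshift (\<lambda>s. coding_term a b s n)" for n
  proof -
    have count: "continuous_on fibonacci_subshift (\<lambda>s. count_ones i s)" for i
      unfolding count_ones_def by (intro continuous_intros continuous_on_product_coordinates[THEN continuous_on_subset]) auto
    have comp: "continuous_on fibonacci_subshift (\<lambda>s. h (f s))"
      if "continuous_on fibonacci_subshift f" for h :: "nat \<Rightarrow> real" and f :: "(nat \<Rightarrow> nat) \<Rightarrow> nat"
      by (rule continuous_on_compose2[OF Topological_Spaces.continuous_on_discrete that]) auto
    show ?thesis unfolding coding_term_def
      by (intro continuous_on_mult comp count
          continuous_on_product_coordinates[THEN continuous_on_subset]
          comp[OF count, of "\<lambda>c. b ^ c"] comp[OF count, of "\<lambda>c. a ^ (Suc n - c)"]) auto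
  qed
  have "uniform_limit fibonacci_subshift (\<lambda>N s. \<Sum>n<N. coding_term a b s n)
      (\<lambda>s. \<Sum>n. coding_term a b s n) sequentially"
  proof (rule Weierstrass_m_test)
    show "summable (\<lambda>n. max a b ^ n)" using assms by (intro summable_geometric) auto
    show "norm (coding_term a b s n) \<le> max a b ^ n" if "s \<in> fibonacci_subshift" for n s
      using coding_term_bounds[OF assms that] by simp
  qed
  then have "continuous_on fibonacci_subshift (\<lambda>s. \<Sum>n. coding_term a b s n)"
    by (rule uniform_limit_theorem[rotated]) (auto intro!: always_eventually continuous_on_sum term_cont)
  then show ?thesis by (simp add: coding_map_eq_suminf[abs_def])
qed

lemma compact_attractor:
  assumes "a \<in> {0<..<1}" "b \<in> {0<..<1}" "c \<in> {0<..<1}" "d \<in> {0<..<1}"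
  shows "compact (attractor a b c d)"
  unfolding attractor_def
  using assms by (intro compact_continuous_image continuous_on_Pair continuous_on_coding_map
      compact_fibonacci_subshift) auto

lemma cyl_point_in_attractor:
  assumes "a \<in> {0<..<1}" "b \<in> {0<..<1}" "c \<in> {0<..<1}" "d \<in> {0<..<1}"
  shows "(cyl_point a b w, cyl_point c d w) \<in> attractor a b c d"
proof -
  have "\<exists>s\<in>fibonacci_subshift. coding_map a b s = cyl_point a b w \<and> coding_map c d s = cyl_point c d w"
  proof (induction w)
    case Nil
    have "(\<lambda>_. 0) \<in> fibonacci_subshift" by (simp add: fibonacci_subshift_def)
    then show ?case by (intro bexI[of _ "\<lambda>_. 0"]) (auto simp: coding_map_def)
  next
    case (Cons i w)
    then obtain s where s: "s \<in> fibonacci_subshift" "coding_map a b s = cyl_point a b w"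
      "coding_map c d s = cyl_point c d w" by blast
    show ?case
    proof (cases i)
      case True
      then show ?thesis using s assms
        by (intro bexI[OF _ fibonacci_subshift_Cons10[OF s(1)]]) (auto simp: coding_map_Cons10[unfolded One_nat_def])
    next
      case False
      then show ?thesis using s assms
        by (intro bexI[OF _ fibonacci_subshift_Cons0[OF s(1)]]) (auto simp: coding_map_Cons0)
    qed
  qed
  then show ?thesis unfolding attractor_def by force
qed

text \<open>
  Every point of the attractor lies in the cylinder of some word of length \<open>n\<close>, which is contained
  in an affine image of the rectangle bounding the attractor.
\<close>

lemma attractor_cover:
  assumes "a \<in> {0<..<1}" "b \<in> {0<..<1}" "c \<in> {0<..<1}" "d \<in> {0<..<1}"
    and "q \<in> attractor a b c d"
  obtains w x y where "w \<in> words n"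
    "x \<in> {0..1 / (1 - max a b)}" "y \<in> {0..1 / (1 - max c d)}"
    "q = (cyl_point a b w + wprod a (a * b) w * x, cyl_point c d w + wprod c (c * d) w * y)"
proof -
  have "\<exists>w\<in>words n. \<exists>s'\<in>fibonacci_subshift.
     coding_map a b s = cyl_point a b w + wprod a (a * b) w * coding_map a b s' \<and>
     coding_map c d s = cyl_point c d w + wprod c (c * d) w * coding_map c d s'"
    if "s \<in> fibonacci_subshift" for s
    using that
  proof (induction n arbitrary: s)
    case 0
    then show ?case by auto
  next
    case (Suc n)
    from Suc.prems show ?case
    proof (cases rule: fibonacci_subshift_cases)
      case (1 r)
      from Suc.IH[OF 1(1)] obtain w s' where ws: "w \<in> words n" "s' \<in> fibonacci_subshift"
        "coding_map a b r = cyl_point a b w + wprod a (a * b) w * coding_map a b s'"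
        "coding_map c d r = cyl_point c d w + wprod c (c * d) w * coding_map c d s'" by blast
      show ?thesis
        by (rule bexI[of _ "False # w"], rule bexI[of _ s'])
          (use ws 1 assms in \<open>auto simp: words_Suc coding_map_Cons0 algebra_simps\<close>)
    next
      case (2 r)
      from Suc.IH[OF 2(1)] obtain w s' where ws: "w \<in> words n" "s' \<in> fibonacci_subshift"
        "coding_map a b r = cyl_point a b w + wprod a (a * b) w * coding_map a b s'"
        "coding_map c d r = cyl_point c d w + wprod c (c * d) w * coding_map c d s'" by blast
      show ?thesis
        by (rule bexI[of _ "True # w"], rule bexI[of _ s'])
          (use ws 2 assms in \<open>auto simp: words_Suc coding_map_Cons10[unfolded One_nat_def] algebra_simps\<close>)
    qed
  qed
  moreover obtain s where s: "s \<in> fibonacci_subshift" "q = (coding_map a b s, coding_map c d s)"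
    using assms(5) by (auto simp: attractor_def)
  ultimately obtain w s' where "w \<in> words n" "s' \<in> fibonacci_subshift"
     "coding_map a b s = cyl_point a b w + wprod a (a * b) w * coding_map a b s'"
     "coding_map c d s = cyl_point c d w + wprod c (c * d) w * coding_map c d s'"
    by blast
  then show thesis
    using s assms coding_map_bounds[of a b s'] coding_map_bounds[of c d s']
    by (intro that[of w "coding_map a b s'" "coding_map c d s'"]) auto
qed

section \<open>The upper bound\<close>

lemma hausdorff_content_le_finite_cover:
  fixes U :: "'i \<Rightarrow> 'a::metric_space set"
  assumes I: "finite I" and cover: "E \<subseteq> (\<Union>i\<in>I. U i)"
    and U: "\<And>i. i \<in> I \<Longrightarrow> bounded (U i)" "\<And>i. i \<in> I \<Longrightarrow> diameter (U i) \<le> \<delta>" and \<delta>: "0 \<le> \<delta>"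
  shows "hausdorff_content t \<delta> E \<le> ennreal (\<Sum>i\<in>I. diam_powr t (U i))"
proof -
  obtain h where h: "bij_betw h {0..<card I} I"
    using ex_bij_betw_nat_finite[OF I] by blast
  define V where "V n = (if n < card I then U (h n) else {})" for n
  have hI: "h n \<in> I" if "n < card I" for n using h that by (auto simp: bij_betw_def)
  have "E \<subseteq> (\<Union>n. V n)"
  proof
    fix x assume "x \<in> E"
    then obtain i where i: "i \<in> I" "x \<in> U i" using cover by auto
    then obtain n where "n < card I" "i = h n" using h by (force simp: bij_betw_def)
    then have "x \<in> V n" using i by (simp add: V_def)
    then show "x \<in> (\<Union>n. V n)" by blast
  qed
  moreover have "bounded (V n) \<and> diameter (V n) \<le> \<delta>" for n
    using U hI \<delta> by (simp add: V_def)
  ultimately have "hausdorff_content t \<delta> E \<le> (\<Sum>n. ennreal (diam_powr t (V n)))"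
    unfolding hausdorff_content_def by (intro INF_lower) auto
  also have "\<dots> = (\<Sum>n\<in>{0..<card I}. ennreal (diam_powr t (V n)))"
    by (rule suminf_finite) (auto simp: V_def diam_powr_def)
  also have "\<dots> = (\<Sum>n\<in>{0..<card I}. ennreal (diam_powr t (U (h n))))"
    by (rule sum.cong) (auto simp: V_def)
  also have "\<dots> = (\<Sum>i\<in>I. ennreal (diam_powr t (U i)))"
    by (rule sum.reindex_bij_betw[OF h])
  also have "\<dots> = ennreal (\<Sum>i\<in>I. diam_powr t (U i))"
    by (rule sum_ennreal) (simp add: diam_powr_def)
  finally show ?thesis .
qed

lemma diam_powr_le:
  assumes "0 < t" "bounded U" "diameter U \<le> r" "0 \<le> r"
  shows "diam_powr t U \<le> r powr t"
  using assms diameter_ge_0[OF assms(2)] by (auto simp: diam_powr_def intro!: powr_mono2)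

lemma diameter_rectangle:
  fixes x y l m :: real
  assumes "0 \<le> l" "0 \<le> m"
  shows "bounded ({x..x + l} \<times> {y..y + m})" "diameter ({x..x + l} \<times> {y..y + m}) \<le> l + m"
proof -
  show "bounded ({x..x + l} \<times> {y..y + m})" by (intro bounded_Times) auto
  show "diameter ({x..x + l} \<times> {y..y + m}) \<le> l + m"
  proof (rule diameter_le)
    fix p q assume "p \<in> {x..x + l} \<times> {y..y + m}" "q \<in> {x..x + l} \<times> {y..y + m}"
    then have "\<bar>fst p - fst q\<bar> \<le> l" "\<bar>snd p - snd q\<bar> \<le> m" by auto
    moreover have "norm (p - q) \<le> \<bar>fst p - fst q\<bar> + \<bar>snd p - snd q\<bar>"
      using norm_Pair_le[of "fst (p - q)" "snd (p - q)"] by (cases p; cases q) simp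
    ultimately show "norm (p - q) \<le> l + m" by linarith
  qed (use assms in auto)
qed

text \<open>
  Here \<open>\<rho> w\<close> and \<open>r w\<close> are the width and the height ratio of the cylinder of \<open>w\<close>. Its bounding
  rectangle is cut into pieces of width \<open>r w\<close>, numbered by \<open>i \<le> N w\<close>.
\<close>

lemma hausdorff_measure_attractor_eq_0:
  assumes "a \<in> {0<..<1}" "b \<in> {0<..<1}" "c \<in> {0<..<1}" "d \<in> {0<..<1}" and t: "0 < t"
    and S1: "a * c powr (t - 1) + a * b * (c * d) powr (t - 1) < 1"
    and S2: "c powr t + (c * d) powr t < 1"
  shows "hausdorff_measure t (attractor a b c d) = 0"
proof -
  define A B where "A = 1 / (1 - max a b)" and "B = 1 / (1 - max c d)"
  have AB: "0 \<le> A" "0 \<le> B" using assms by (auto simp: A_def B_def)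
  define \<rho> r where "\<rho> = wprod a (a * b)" and "r = wprod c (c * d)"
  have pos: "0 < \<rho> w" "0 < r w" for w using assms by (auto simp: \<rho>_def r_def intro!: wprod_pos)
  define N where "N w = nat \<lfloor>\<rho> w * A / r w\<rfloor>" for w
  define U where "U = (\<lambda>(w, i). {cyl_point a b w + real i * r w..cyl_point a b w + real i * r w + r w} \<times>
      {cyl_point c d w..cyl_point c d w + r w * B})"
  define I where "I n = Sigma (words n) (\<lambda>w. {..N w})" for n
  define S1' S2' where "S1' = a * c powr (t - 1) + a * b * (c * d) powr (t - 1)"
    and "S2' = c powr t + (c * d) powr t"
  define f where "f n = (1 + B) powr t * (A * S1' ^ n + S2' ^ n)" for n
  have U_bounded: "bounded (U (w, i))" and U_diam: "diameter (U (w, i)) \<le> r w * (1 + B)" for w i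
    using diameter_rectangle[of "r w" "r w * B"] pos[of w] AB
    by (simp_all add: U_def distrib_left less_imp_le)
  have cover: "attractor a b c d \<subseteq> (\<Union>j\<in>I n. U j)" for n
  proof
    fix q assume "q \<in> attractor a b c d"
    then obtain w x y where w: "w \<in> words n" "x \<in> {0..A}" "y \<in> {0..B}"
      and q: "q = (cyl_point a b w + \<rho> w * x, cyl_point c d w + r w * y)"
      using attractor_cover[OF assms(1-4), of q n] unfolding A_def B_def \<rho>_def r_def by metis
    define i where "i = nat \<lfloor>\<rho> w * x / r w\<rfloor>"
    have nonneg: "0 \<le> \<rho> w * x / r w" using pos[of w] w by simp
    have "\<rho> w * x / r w \<le> \<rho> w * A / r w"
      using pos[of w] w by (intro divide_right_mono mult_left_mono) auto
    then have "i \<le> N w" unfolding i_def N_def by (intro nat_mono floor_mono)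
    moreover have "q \<in> U (w, i)"
    proof -
      have "real i = of_int \<lfloor>\<rho> w * x / r w\<rfloor>" using nonneg by (simp add: i_def)
      then have "real i \<le> \<rho> w * x / r w" "\<rho> w * x / r w \<le> real i + 1" by linarith+
      then have "real i * r w \<le> \<rho> w * x" "\<rho> w * x \<le> (real i + 1) * r w"
        using pos[of w] by (simp_all add: pos_le_divide_eq pos_divide_le_eq)
      moreover have "r w * y \<le> r w * B" using w pos[of w] by (intro mult_left_mono) auto
      ultimately show ?thesis using w pos[of w] by (simp add: U_def q algebra_simps)
    qed
    ultimately show "q \<in> (\<Union>j\<in>I n. U j)" using w by (auto simp: I_def)
  qed
  have sum_le: "(\<Sum>j\<in>I n. diam_powr t (U j)) \<le> f n" for n
  proof -
    have "(\<Sum>j\<in>I n. diam_powr t (U j)) = (\<Sum>w\<in>words n. \<Sum>i\<le>N w. diam_powr t (U (w, i)))"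
      unfolding I_def by (subst sum.Sigma) auto
    also have "\<dots> \<le> (\<Sum>w\<in>words n. (1 + B) powr t * (A * (\<rho> w * r w powr (t - 1)) + r w powr t))"
    proof (rule sum_mono)
      fix w
      have nonneg: "0 \<le> \<rho> w * A / r w" using pos[of w] AB by simp
      have "(\<Sum>i\<le>N w. diam_powr t (U (w, i))) \<le> (\<Sum>i\<le>N w. (r w * (1 + B)) powr t)"
        using U_bounded U_diam t pos[of w] AB
        by (intro sum_mono diam_powr_le) auto
      also have "\<dots> = (real (N w) + 1) * (r w * (1 + B)) powr t" by (simp add: algebra_simps)
      also have "\<dots> \<le> (\<rho> w * A / r w + 1) * (r w * (1 + B)) powr t"
        using nonneg by (intro mult_right_mono) (auto simp: N_def)
      also have "\<dots> = (1 + B) powr t * (A * (\<rho> w * (r w powr t / r w)) + r w powr t)"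
        using pos[of w] AB by (simp add: powr_mult) (simp add: field_simps)
      also have "r w powr t / r w = r w powr (t - 1)"
        using pos[of w] by (simp add: powr_diff)
      finally show "(\<Sum>i\<le>N w. diam_powr t (U (w, i))) \<le>
          (1 + B) powr t * (A * (\<rho> w * r w powr (t - 1)) + r w powr t)" .
    qed
    also have "\<dots> = (1 + B) powr t *
        (A * (\<Sum>w\<in>words n. \<rho> w * r w powr (t - 1)) + (\<Sum>w\<in>words n. r w powr t))"
      by (simp add: sum_distrib_left sum.distrib distrib_left)
    also have "(\<Sum>w\<in>words n. \<rho> w * r w powr (t - 1)) = S1' ^ n"
      using assms by (simp add: \<rho>_def r_def wprod_powr wprod_mult sum_words_wprod S1'_def)
    also have "(\<Sum>w\<in>words n. r w powr t) = S2' ^ n"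
      using assms by (simp add: r_def wprod_powr sum_words_wprod S2'_def)
    finally show ?thesis by (simp add: f_def)
  qed
  have "f \<longlonglongrightarrow> (1 + B) powr t * (A * 0 + 0)"
    unfolding f_def using assms S1 S2
    by (intro tendsto_intros LIMSEQ_realpow_zero) (auto simp: S1'_def S2'_def)
  then have f_lim: "(\<lambda>n. ennreal (f n)) \<longlonglongrightarrow> 0"
    using tendsto_ennrealI by fastforce
  have "hausdorff_content t \<delta> (attractor a b c d) = 0" if \<delta>: "0 < \<delta>" for \<delta>
  proof -
    have "(\<lambda>n. c ^ n * (1 + B)) \<longlonglongrightarrow> 0 * (1 + B)"
      using assms by (intro tendsto_intros LIMSEQ_realpow_zero) auto
    then have "eventually (\<lambda>n. c ^ n * (1 + B) < \<delta>) sequentially"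
      using \<delta> by (intro order_tendstoD(2)) auto
    then have "eventually (\<lambda>n. hausdorff_content t \<delta> (attractor a b c d) \<le> ennreal (f n)) sequentially"
    proof eventually_elim
      case (elim n)
      have "hausdorff_content t \<delta> (attractor a b c d) \<le> ennreal (\<Sum>j\<in>I n. diam_powr t (U j))"
      proof (rule hausdorff_content_le_finite_cover[OF _ cover])
        show "finite (I n)" by (simp add: I_def)
        fix j assume "j \<in> I n"
        then obtain w i where j: "j = (w, i)" "w \<in> words n" by (auto simp: I_def)
        show "bounded (U j)" using U_bounded j by simp
        have "c * d \<le> c * 1" using assms by (intro mult_left_mono) auto
        then have "r w \<le> wprod c c w" unfolding r_def using assms wprod_mono[of c "c * d" c c w] by auto
        then have "r w \<le> c ^ n" using j by (simp add: wprod_const words_def)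
        then have "r w * (1 + B) \<le> c ^ n * (1 + B)" using AB by (intro mult_right_mono) auto
        then show "diameter (U j) \<le> \<delta>" using U_diam[of w i] elim j by simp
      qed (use \<delta> in simp)
      also have "\<dots> \<le> ennreal (f n)" by (intro ennreal_leI sum_le)
      finally show ?case .
    qed
    then have "hausdorff_content t \<delta> (attractor a b c d) \<le> 0"
      by (intro tendsto_lowerbound[OF f_lim]) auto
    then show ?thesis by simp
  qed
  then show ?thesis unfolding hausdorff_measure_def by simp
qed

section \<open>A discrete energy criterion for positive Hausdorff measure\<close>

text \<open>
  Used to enlarge the sets of a cover to open balls at an arbitrarily small cost.
\<close>

lemma powr_thicken:
  fixes d e t :: real
  assumes "0 \<le> d" "0 < t" "0 < e"
  obtains r where "d < r" "r powr t \<le> d powr t + e"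
proof -
  have "((\<lambda>r. r powr t) \<longlongrightarrow> d powr t) (at_right d)"
  proof -
    have "continuous_on {0..} (\<lambda>r::real. r powr t)"
      using assms by (intro continuous_on_powr') auto
    then have "((\<lambda>r. r powr t) \<longlongrightarrow> d powr t) (at d within {0..})"
      using assms by (auto simp: continuous_on_def)
    moreover have "at_right d \<le> at d within {0..}"
      using assms by (intro at_le) auto
    ultimately show ?thesis by (rule tendsto_mono[rotated])
  qed
  then have "eventually (\<lambda>r. r powr t < d powr t + e) (at_right d)"
    by (rule order_tendstoD) (use assms in simp)
  moreover have "eventually (\<lambda>r. d < r) (at_right d)"
    by (simp add: eventually_at_right_less)
  ultimately have "eventually (\<lambda>r. d < r \<and> r powr t < d powr t + e) (at_right d)"
    by eventually_elim auto
  then obtain r where "d < r" "r powr t < d powr t + e"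
    using eventually_happens'[OF trivial_limit_at_right_real] by blast
  then show thesis using that by force
qed

text \<open>
  The core of the energy criterion: the point masses are distributed over finitely many balls covering
  them, giving masses \<open>m j\<close> with sum 1, and by the Cauchy--Schwarz inequality
  \<open>1 \<le> (\<Sum> (m j)^2 (2 d_j)^(-t)) (\<Sum> (2 d_j)^t)\<close>. In the first factor, pairs of different points are
  controlled by the energy, and the diagonal terms by the smallness of the sum of the squared masses.
\<close>

lemma sum_fibres_powr_bound:
  fixes E :: "'a::metric_space set" and P :: "'i \<Rightarrow> 'a" and p :: "'i \<Rightarrow> real"
  assumes fin: "finite J" "finite W" and t: "0 < t"
    and d: "\<And>j. j \<in> J \<Longrightarrow> 0 < d j" "\<And>j. j \<in> J \<Longrightarrow> \<rho> \<le> d j" and \<rho>: "0 < \<rho>"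
    and cover: "\<And>w. w \<in> W \<Longrightarrow> \<exists>j\<in>J. P w \<in> ball (x j) (d j)"
    and p: "\<And>w. w \<in> W \<Longrightarrow> 0 \<le> p w" "sum p W = 1"
    and inj: "inj_on P W"
    and energy: "(\<Sum>w\<in>W. \<Sum>w'\<in>W. if w = w' then 0 else p w * p w' * dist (P w) (P w') powr (- t)) \<le> M"
    and diag: "(\<Sum>w\<in>W. (p w)\<^sup>2) \<le> (2 * \<rho>) powr t"
  shows "1 \<le> (M + 1) * (\<Sum>j\<in>J. (2 * d j) powr t)"
proof -
  define sel where "sel w = (SOME j. j \<in> J \<and> P w \<in> ball (x j) (d j))" for w
  have sel: "sel w \<in> J" "P w \<in> ball (x (sel w)) (d (sel w))" if "w \<in> W" for w
    using someI_ex[of "\<lambda>j. j \<in> J \<and> P w \<in> ball (x j) (d j)"] cover[OF that]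
    by (auto simp: sel_def)
  define F where "F j = {w \<in> W. sel w = j}" for j
  define m where "m j = sum p (F j)" for j
  define k where "k w w' = (if w = w' then 0 else p w * p w' * dist (P w) (P w') powr (- t))" for w w'
  have finF: "finite (F j)" for j using fin by (simp add: F_def)
  have k_nonneg: "0 \<le> k w w'" if "w \<in> W" "w' \<in> W" for w w'
    using that p(1) by (auto simp: k_def)
  have sum_F: "(\<Sum>j\<in>J. sum h (F j)) = sum h W" for h :: "'i \<Rightarrow> real"
    unfolding F_def using fin sel by (intro sum.group) auto
  have m_sum: "(\<Sum>j\<in>J. m j) = 1" unfolding m_def sum_F by (rule p(2))
  have pair: "p w * p w' * (2 * d j) powr (- t) \<le>
      k w w' + (if w = w' then (p w)\<^sup>2 * (2 * \<rho>) powr (- t) else 0)"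
    if "j \<in> J" "w \<in> F j" "w' \<in> F j" for j w w'
  proof (cases "w = w'")
    case True
    have "(2 * d j) powr (- t) \<le> (2 * \<rho>) powr (- t)"
      using d[OF that(1)] \<rho> t by (intro powr_mono2') auto
    then have "(p w)\<^sup>2 * (2 * d j) powr (- t) \<le> (p w)\<^sup>2 * (2 * \<rho>) powr (- t)"
      by (intro mult_left_mono) auto
    then show ?thesis using True by (simp add: k_def power2_eq_square)
  next
    case False
    have ww: "w \<in> W" "w' \<in> W" using that by (auto simp: F_def)
    have "P w \<noteq> P w'" using inj False ww by (auto dest: inj_onD)
    moreover have "dist (P w) (P w') \<le> 2 * d j"
      using sel(2)[OF ww(1)] sel(2)[OF ww(2)] that dist_triangle3[of "P w" "P w'" "x j"]
      by (auto simp: F_def)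
    ultimately have "(2 * d j) powr (- t) \<le> dist (P w) (P w') powr (- t)"
      using t by (intro powr_mono2') auto
    then have "p w * p w' * (2 * d j) powr (- t) \<le> p w * p w' * dist (P w) (P w') powr (- t)"
      using p(1) ww by (intro mult_left_mono) auto
    then show ?thesis using False by (simp add: k_def)
  qed
  have fibre: "(m j)\<^sup>2 * (2 * d j) powr (- t) \<le>
      (\<Sum>w\<in>F j. \<Sum>w'\<in>W. k w w') + (2 * \<rho>) powr (- t) * (\<Sum>w\<in>F j. (p w)\<^sup>2)" if j: "j \<in> J" for j
  proof -
    have "(m j)\<^sup>2 * (2 * d j) powr (- t) = (\<Sum>w\<in>F j. \<Sum>w'\<in>F j. p w * p w' * (2 * d j) powr (- t))"
      unfolding m_def power2_eq_square sum_product by (simp add: sum_distrib_right)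
    also have "\<dots> \<le> (\<Sum>w\<in>F j. \<Sum>w'\<in>F j. k w w' + (if w = w' then (p w)\<^sup>2 * (2 * \<rho>) powr (- t) else 0))"
      using pair[OF j] by (intro sum_mono) auto
    also have "\<dots> = (\<Sum>w\<in>F j. \<Sum>w'\<in>F j. k w w') + (2 * \<rho>) powr (- t) * (\<Sum>w\<in>F j. (p w)\<^sup>2)"
      using finF by (simp add: sum.distrib sum_distrib_left mult.commute)
    also have "(\<Sum>w\<in>F j. \<Sum>w'\<in>F j. k w w') \<le> (\<Sum>w\<in>F j. \<Sum>w'\<in>W. k w w')"
      using fin k_nonneg by (intro sum_mono sum_mono2) (auto simp: F_def)
    finally show ?thesis by simp
  qed
  have "(\<Sum>j\<in>J. (m j)\<^sup>2 * (2 * d j) powr (- t)) \<le>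
      (\<Sum>j\<in>J. (\<Sum>w\<in>F j. \<Sum>w'\<in>W. k w w') + (2 * \<rho>) powr (- t) * (\<Sum>w\<in>F j. (p w)\<^sup>2))"
    by (intro sum_mono fibre)
  also have "\<dots> = (\<Sum>w\<in>W. \<Sum>w'\<in>W. k w w') + (2 * \<rho>) powr (- t) * (\<Sum>w\<in>W. (p w)\<^sup>2)"
    by (simp add: sum.distrib sum_distrib_left[symmetric] sum_F)
  also have "\<dots> \<le> M + (2 * \<rho>) powr (- t) * (2 * \<rho>) powr t"
    using energy diag by (intro add_mono mult_left_mono) (auto simp: k_def)
  also have "(2 * \<rho>) powr (- t) * (2 * \<rho>) powr t = 1"
    using \<rho> by (simp add: powr_add[symmetric])
  finally have msq: "(\<Sum>j\<in>J. (m j)\<^sup>2 * (2 * d j) powr (- t)) \<le> M + 1" .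
  have "1 = (\<Sum>j\<in>J. (m j * (2 * d j) powr (- t / 2)) * (2 * d j) powr (t / 2))\<^sup>2"
  proof -
    have "(m j * (2 * d j) powr (- t / 2)) * (2 * d j) powr (t / 2) = m j" if "j \<in> J" for j
      unfolding mult.assoc powr_add[symmetric] using d(1)[OF that] by simp
    then have "(\<Sum>j\<in>J. (m j * (2 * d j) powr (- t / 2)) * (2 * d j) powr (t / 2)) = (\<Sum>j\<in>J. m j)"
      by (rule sum.cong[OF refl])
    then show ?thesis using m_sum by simp
  qed
  also have "\<dots> \<le> (\<Sum>j\<in>J. (m j * (2 * d j) powr (- t / 2))\<^sup>2) * (\<Sum>j\<in>J. ((2 * d j) powr (t / 2))\<^sup>2)"
    by (rule Cauchy_Schwarz_ineq_sum)
  also have "\<dots> = (\<Sum>j\<in>J. (m j)\<^sup>2 * (2 * d j) powr (- t)) * (\<Sum>j\<in>J. (2 * d j) powr t)"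
    by (simp add: power_mult_distrib power2_eq_square[of "_ powr _"] powr_add[symmetric])
  also have "\<dots> \<le> (M + 1) * (\<Sum>j\<in>J. (2 * d j) powr t)"
    using msq by (intro mult_right_mono sum_nonneg) auto
  finally show ?thesis .
qed

lemma diam_powr_mono:
  assumes "0 \<le> s" "s \<le> t" "0 < t" "bounded U" "diameter U \<le> 1"
  shows "diam_powr t U \<le> diam_powr s U"
proof -
  have "0 \<le> diameter U" by (rule diameter_ge_0) fact
  then have "diameter U powr t \<le> 1" using assms by (intro powr_le1) auto
  moreover have "diameter U powr t \<le> diameter U powr s"
    using assms by (intro powr_mono') (auto intro: diameter_ge_0)
  ultimately show ?thesis using assms by (auto simp: diam_powr_def)
qed

text \<open>
  A discrete Frostman criterion. The approximating measures need not converge: compactness of \<open>E\<close>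
  reduces a cover to finitely many balls, so a single measure with sufficiently small atoms suffices.
\<close>

lemma hausdorff_measure_pos_of_discrete_energy:
  fixes E :: "'a::metric_space set"
  assumes E: "compact E" and s: "0 \<le> s" "s \<le> t" "0 < t"
    and approx: "\<And>\<eta>. 0 < \<eta> \<Longrightarrow> \<exists>(W::'i set) P p. finite W \<and> P ` W \<subseteq> E \<and> inj_on P W \<and>
      (\<forall>w\<in>W. 0 \<le> p w) \<and> sum p W = 1 \<and> (\<Sum>w\<in>W. (p w)\<^sup>2) \<le> \<eta> \<and>
      (\<Sum>w\<in>W. \<Sum>w'\<in>W. if w = w' then 0 else p w * p w' * dist (P w) (P w') powr (- t)) \<le> M"
  shows "hausdorff_measure s E \<noteq> 0"
proof
  assume zero: "hausdorff_measure s E = 0"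
  have M: "0 \<le> M"
  proof -
    obtain W :: "'i set" and P :: "'i \<Rightarrow> 'a" and p :: "'i \<Rightarrow> real" where
      *: "\<forall>w\<in>W. 0 \<le> p w"
      "(\<Sum>w\<in>W. \<Sum>w'\<in>W. if w = w' then 0 else p w * p w' * dist (P w) (P w') powr (- t)) \<le> M"
      using approx[of 1] by auto
    have "0 \<le> (\<Sum>w\<in>W. \<Sum>w'\<in>W. if w = w' then 0 else p w * p w' * dist (P w) (P w') powr (- t))"
      using *(1) by (intro sum_nonneg) auto
    then show ?thesis using *(2) by linarith
  qed
  \<comment> \<open>a cover by sets whose diameter powers sum to less than \<open>\<epsilon>\<close> would yield \<open>1 \<le> 1 / 2\<close>\<close>
  define \<epsilon> where "\<epsilon> = 1 / (4 * (M + 1) * 2 powr t)"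
  have \<epsilon>: "0 < \<epsilon>" using M by (simp add: \<epsilon>_def)
  have "hausdorff_content s 1 E \<le> hausdorff_measure s E"
    unfolding hausdorff_measure_def by (rule SUP_upper) auto
  then have "hausdorff_content s 1 E < ennreal \<epsilon>" using zero \<epsilon> by simp
  then obtain U where U: "E \<subseteq> (\<Union>n. U n)" "\<And>n. bounded (U n)" "\<And>n. diameter (U n) \<le> 1"
    and U_sum: "(\<Sum>n. ennreal (diam_powr s (U n))) < ennreal \<epsilon>"
    unfolding hausdorff_content_def by (auto simp: INF_less_iff)
  have nonneg: "0 \<le> diam_powr t (U n)" for n by (simp add: diam_powr_def)
  have "(\<Sum>n. ennreal (diam_powr t (U n))) \<le> (\<Sum>n. ennreal (diam_powr s (U n)))"
    using diam_powr_mono[OF s U(2,3)] by (intro suminf_le) (auto intro: ennreal_leI)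
  then have sum_t: "(\<Sum>n. ennreal (diam_powr t (U n))) < ennreal \<epsilon>" using U_sum by (rule order.strict_trans1)
  have partial: "(\<Sum>n\<in>N. diam_powr t (U n)) \<le> \<epsilon>" if "finite N" for N
  proof -
    have "ennreal (\<Sum>n\<in>N. diam_powr t (U n)) = (\<Sum>n\<in>N. ennreal (diam_powr t (U n)))"
      using nonneg by simp
    also have "\<dots> \<le> (\<Sum>n. ennreal (diam_powr t (U n)))" by (rule sum_le_suminf) (use that in auto)
    also have "\<dots> < ennreal \<epsilon>" by (rule sum_t)
    finally show ?thesis using \<epsilon> by (simp add: ennreal_less_iff less_imp_le sum_nonneg nonneg)
  qed
  have "\<exists>r. diameter (U n) < r \<and> r powr t \<le> diameter (U n) powr t + \<epsilon> * (1 / 2) ^ Suc n" for n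
    using powr_thicken[of "diameter (U n)" t "\<epsilon> * (1 / 2) ^ Suc n"] \<epsilon> s U(2)
    by (metis diameter_ge_0 mult_pos_pos zero_less_divide_1_iff zero_less_numeral zero_less_power)
  then obtain d where d: "\<And>n. diameter (U n) < d n"
    "\<And>n. d n powr t \<le> diameter (U n) powr t + \<epsilon> * (1 / 2) ^ Suc n" by metis
  have d_pos: "0 < d n" for n using d(1)[of n] diameter_ge_0[OF U(2)[of n]] by linarith
  define N where "N = {n. U n \<noteq> {}}"
  define x where "x n = (SOME y. y \<in> U n)" for n
  have x: "x n \<in> U n" if "n \<in> N" for n using that by (auto simp: N_def x_def some_in_eq)
  have "E \<subseteq> (\<Union>n\<in>N. ball (x n) (d n))"
  proof
    fix y assume "y \<in> E"
    then obtain n where n: "y \<in> U n" using U by auto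
    then have "n \<in> N" by (auto simp: N_def)
    moreover have "dist (x n) y < d n"
      using diameter_bounded_bound[OF U(2) x[OF \<open>n \<in> N\<close>] n] d(1)[of n] by linarith
    ultimately show "y \<in> (\<Union>n\<in>N. ball (x n) (d n))" by auto
  qed
  then obtain J where J: "J \<subseteq> N" "finite J" "E \<subseteq> (\<Union>n\<in>J. ball (x n) (d n))"
    using compactE_image[OF E, of N "\<lambda>n. ball (x n) (d n)"] by auto
  define \<rho> where "\<rho> = Min (insert 1 (d ` J))"
  have \<rho>: "0 < \<rho>" "\<And>j. j \<in> J \<Longrightarrow> \<rho> \<le> d j"
    using J d_pos by (auto simp: \<rho>_def)
  have "0 < (2 * \<rho>) powr t" using \<rho> by simp
  from approx[OF this] obtain W :: "'i set" and P :: "'i \<Rightarrow> 'a" and p :: "'i \<Rightarrow> real"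
    where W: "finite W \<and> P ` W \<subseteq> E \<and> inj_on P W \<and>
      (\<forall>w\<in>W. 0 \<le> p w) \<and> sum p W = 1 \<and> (\<Sum>w\<in>W. (p w)\<^sup>2) \<le> (2 * \<rho>) powr t \<and>
      (\<Sum>w\<in>W. \<Sum>w'\<in>W. if w = w' then 0 else p w * p w' * dist (P w) (P w') powr (- t)) \<le> M"
    by (elim exE) (rule that)
  have "1 \<le> (M + 1) * (\<Sum>j\<in>J. (2 * d j) powr t)"
  proof (rule sum_fibres_powr_bound[where W = W and P = P and p = p and \<rho> = \<rho> and t = t and x = x])
    show "\<exists>j\<in>J. P w \<in> ball (x j) (d j)" if "w \<in> W" for w using that W J(3) by blast
  qed (use W J(2) \<rho> d_pos s(3) in simp_all)
  moreover have "(\<Sum>j\<in>J. (2 * d j) powr t) \<le> 2 powr t * (2 * \<epsilon>)"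
  proof -
    have "(\<Sum>j\<in>J. d j powr t) \<le> (\<Sum>j\<in>J. diam_powr t (U j) + \<epsilon> * (1 / 2) ^ Suc j)"
      using d(2) J s by (intro sum_mono) (auto simp: diam_powr_def N_def)
    also have "\<dots> = (\<Sum>j\<in>J. diam_powr t (U j)) + \<epsilon> * (\<Sum>j\<in>J. (1 / 2) ^ Suc j)"
      by (simp add: sum.distrib sum_distrib_left)
    also have "\<dots> \<le> \<epsilon> + \<epsilon> * 1"
    proof (intro add_mono mult_left_mono)
      have "(\<Sum>j\<in>J. (1 / 2) ^ Suc j) \<le> (\<Sum>j. (1 / 2 :: real) ^ Suc j)"
        using J power_half_series by (intro sum_le_suminf) (auto simp: sums_iff)
      then show "(\<Sum>j\<in>J. (1 / 2 :: real) ^ Suc j) \<le> 1" using power_half_series by (simp add: sums_iff)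
    qed (use partial J \<epsilon> in auto)
    finally have "2 powr t * (\<Sum>j\<in>J. d j powr t) \<le> 2 powr t * (2 * \<epsilon>)"
      by (intro mult_left_mono) auto
    then show ?thesis using d_pos by (simp add: powr_mult sum_distrib_left less_imp_le)
  qed
  ultimately have "1 \<le> (M + 1) * (2 powr t * (2 * \<epsilon>))"
    using M by (meson add_nonneg_nonneg mult_left_mono order_trans zero_le_one)
  also have "\<dots> = ((M + 1) * 2 powr t) / ((M + 1) * 2 powr t) / 2" by (simp add: \<epsilon>_def)
  also have "\<dots> = 1 / 2" using M by simp
  finally show False by simp
qed

section \<open>Integrals of transversal kernels\<close>

lemma nn_integral_kernel_finite:
  fixes t :: real
  assumes t: "1 < t"
  shows "(\<integral>\<^sup>+s. ennreal ((1 + \<bar>s\<bar>) powr (- t)) \<partial>lborel) < \<infinity>"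
proof -
  define h :: "real \<Rightarrow> ennreal" where "h s = ennreal ((1 + s) powr (- t)) * indicator {0..} s" for s
  have [measurable]: "h \<in> borel_measurable borel" unfolding h_def by measurable
  have "((\<lambda>s. (1 + s) powr (1 - t) / (1 - t)) \<longlongrightarrow> 0 / (1 - t)) at_top"
    using t by (intro tendsto_intros tendsto_neg_powr filterlim_tendsto_add_at_top[OF tendsto_const] filterlim_ident) auto
  then have lim: "((\<lambda>s. (1 + s) powr (1 - t) / (1 - t)) \<longlongrightarrow> 0) at_top" by simp
  have "(\<integral>\<^sup>+s. h s \<partial>lborel) = ennreal (0 - (1 + 0) powr (1 - t) / (1 - t))"
    unfolding h_def
  proof (rule nn_integral_FTC_atLeast[OF _ _ _ lim])
    fix s :: real assume "0 \<le> s"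
    then show "((\<lambda>s. (1 + s) powr (1 - t) / (1 - t)) has_real_derivative (1 + s) powr (- t)) (at s)"
      using t by (auto intro!: derivative_eq_intros)
  qed auto
  then have fin: "(\<integral>\<^sup>+s. h s \<partial>lborel) < \<infinity>" by simp
  have "(\<integral>\<^sup>+s. ennreal ((1 + \<bar>s\<bar>) powr (- t)) \<partial>lborel) \<le> (\<integral>\<^sup>+s. h s + h (- s) \<partial>lborel)"
    by (intro nn_integral_mono) (auto simp: h_def indicator_def)
  also have "\<dots> = (\<integral>\<^sup>+s. h s \<partial>lborel) + (\<integral>\<^sup>+s. h (- s) \<partial>lborel)"
    by (rule nn_integral_add) measurable
  also have "(\<integral>\<^sup>+s. h (- s) \<partial>lborel) = (\<integral>\<^sup>+s. h s \<partial>lborel)"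
    using nn_integral_real_affine[of h "-1" 0] by simp
  finally show ?thesis using fin by (simp add: order.strict_trans1)
qed

text \<open>
  The integral of \<open>(1 + |s|)^(-t)\<close> over the real line, which is finite for \<open>t > 1\<close>.
\<close>

definition kernel_integral :: "real \<Rightarrow> real" where
  "kernel_integral t = enn2real (\<integral>\<^sup>+s. ennreal ((1 + \<bar>s\<bar>) powr (- t)) \<partial>lborel)"

lemma kernel_integral_nonneg: "0 \<le> kernel_integral t"
  by (simp add: kernel_integral_def)

text \<open>
  The bound \<open>f s \<ge> (B / 2) (1 + (A / B) |s - s0|)\<close> reduces the claim, by an affine substitution, to the
  integral above.
\<close>

lemma nn_integral_transversal:
  fixes f :: "real \<Rightarrow> real"
  assumes t: "1 < t" and AB: "0 < A" "0 < B"
    and f: "\<And>s. s \<in> S \<Longrightarrow> A * \<bar>s - s0\<bar> \<le> f s" "\<And>s. s \<in> S \<Longrightarrow> B \<le> f s"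
  shows "(\<integral>\<^sup>+s. ennreal (f s powr (- t)) * indicator S s \<partial>lborel) \<le>
    ennreal (2 powr t * kernel_integral t * B powr (1 - t) / A)"
proof -
  define h :: "real \<Rightarrow> ennreal" where "h s = ennreal ((1 + \<bar>s\<bar>) powr (- t))" for s
  have [measurable]: "h \<in> borel_measurable borel" unfolding h_def by measurable
  have h_int: "(\<integral>\<^sup>+s. h s \<partial>lborel) = ennreal (kernel_integral t)"
    using nn_integral_kernel_finite[OF t] unfolding kernel_integral_def h_def by simp
  have pw: "ennreal (f s powr (- t)) * indicator S s \<le>
      ennreal ((B / 2) powr (- t)) * h (- (A / B) * s0 + A / B * s)" for s
  proof (cases "s \<in> S")
    case True
    define z where "z = 1 + \<bar>- (A / B) * s0 + A / B * s\<bar>"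
    have "- (A / B) * s0 + A / B * s = A / B * (s - s0)" using AB by (simp add: field_simps)
    then have z: "z = 1 + A / B * \<bar>s - s0\<bar>" using AB by (simp add: z_def abs_mult)
    then have "B / 2 * z = (B + A * \<bar>s - s0\<bar>) / 2" using AB by (simp add: field_simps)
    also have "\<dots> \<le> f s" using f[OF True] by simp
    finally have "B / 2 * z \<le> f s" .
    moreover have "0 < z" by (simp add: z_def)
    ultimately have "f s powr (- t) \<le> (B / 2 * z) powr (- t)"
      using AB t by (intro powr_mono2') auto
    also have "\<dots> = (B / 2) powr (- t) * z powr (- t)"
      by (rule powr_mult)
    finally have "ennreal (f s powr (- t)) \<le> ennreal ((B / 2) powr (- t) * z powr (- t))"
      by (rule ennreal_leI)
    then show ?thesis using True by (simp add: h_def z_def ennreal_mult)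
  qed simp
  have "(\<integral>\<^sup>+s. ennreal (f s powr (- t)) * indicator S s \<partial>lborel) \<le>
      (\<integral>\<^sup>+s. ennreal ((B / 2) powr (- t)) * h (- (A / B) * s0 + A / B * s) \<partial>lborel)"
    by (intro nn_integral_mono pw)
  also have "\<dots> = ennreal ((B / 2) powr (- t)) * (\<integral>\<^sup>+s. h (- (A / B) * s0 + A / B * s) \<partial>lborel)"
    by (rule nn_integral_cmult) measurable
  also have "(\<integral>\<^sup>+s. h (- (A / B) * s0 + A / B * s) \<partial>lborel) = ennreal (B / A * kernel_integral t)"
  proof -
    have "ennreal (kernel_integral t) = ennreal (A / B) * (\<integral>\<^sup>+s. h (- (A / B) * s0 + A / B * s) \<partial>lborel)"
      using nn_integral_real_affine[of h "A / B" "- (A / B) * s0"] h_int AB by simp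
    then have "ennreal (B / A) * ennreal (kernel_integral t) =
        ennreal (B / A) * (ennreal (A / B) * (\<integral>\<^sup>+s. h (- (A / B) * s0 + A / B * s) \<partial>lborel))" by simp
    also have "\<dots> = ennreal (B / A * (A / B)) * (\<integral>\<^sup>+s. h (- (A / B) * s0 + A / B * s) \<partial>lborel)"
      using AB by (subst ennreal_mult) (auto simp: mult.assoc)
    also have "B / A * (A / B) = 1" using AB by simp
    finally have "(\<integral>\<^sup>+s. h (- (A / B) * s0 + A / B * s) \<partial>lborel) =
        ennreal (B / A) * ennreal (kernel_integral t)" by simp
    also have "\<dots> = ennreal (B / A * kernel_integral t)"
      using AB kernel_integral_nonneg[of t] by (intro ennreal_mult[symmetric]) auto
    finally show ?thesis .
  qed
  also have "ennreal ((B / 2) powr (- t)) * ennreal (B / A * kernel_integral t) =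
      ennreal ((B / 2) powr (- t) * (B / A * kernel_integral t))"
    using AB kernel_integral_nonneg[of t] by (intro ennreal_mult[symmetric]) auto
  also have "(B / 2) powr (- t) * (B / A * kernel_integral t) =
      2 powr t * kernel_integral t * B powr (1 - t) / A"
    using AB by (simp add: powr_divide powr_minus powr_diff field_simps)
  finally show ?thesis .
qed

section \<open>The energy of the coded set, averaged over the parameters\<close>

text \<open>
  The contraction parameters of the second coordinate are \<open>c = \<tau>1\<close> and \<open>d = \<tau>2\<close>; \<open>(b1, b2)\<close> is the lower
  corner of the rectangle of parameters \<open>(\<beta>1, \<beta>2)\<close> over which energies are averaged.
\<close>

locale energy_estimate =
  fixes c d t b1 b2 S :: real
  assumes c: "0 < c" "c < 1" and d: "0 < d" "d < 1" and cd: "c + c * d < 1"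
    and t: "1 < t"
    and b1: "0 < b1" "b1 < 0.739" and b2: "0 < b2" "b2 < 0.739"
    and S_eq: "S = b1 * c powr (t - 1) + b1 * b2 * (c * d) powr (t - 1)"
    and S_gt_1: "1 < S"
begin

text \<open>
  The probabilities of the letters \<open>False\<close> and \<open>True\<close>, and the resulting probability of a word. They
  depend on the corner \<open>(b1, b2)\<close>, not on the parameters that are averaged over.
\<close>

definition p0 :: real where "p0 = b1 * c powr (t - 1) / S"

definition p1 :: real where "p1 = b1 * b2 * (c * d) powr (t - 1) / S"

definition prob :: "bool list \<Rightarrow> real" where "prob w = wprod p0 p1 w"

text \<open>
  The point of the attractor coded by the word \<open>w\<close>, for the parameters \<open>x = (\<beta>1, \<beta>2)\<close>.
\<close>

definition pt :: "real \<times> real \<Rightarrow> bool list \<Rightarrow> real \<times> real" where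
  "pt x w = (cyl_point (fst x) (snd x) w, cyl_point c d w)"

text \<open>
  The contribution of a pair of words to the energy. The diagonal is left out.
\<close>

definition kern :: "real \<times> real \<Rightarrow> bool list \<Rightarrow> bool list \<Rightarrow> real" where
  "kern x w w' = (if w = w' then 0 else prob w * prob w' * dist (pt x w) (pt x w') powr (- t))"

text \<open>
  The energy of the words of length \<open>n\<close> following the prefix \<open>v\<close>.
\<close>

definition energy :: "nat \<Rightarrow> bool list \<Rightarrow> real \<times> real \<Rightarrow> real" where
  "energy n v x = (\<Sum>w\<in>words n. \<Sum>w'\<in>words n. kern x (v @ w) (v @ w'))"

text \<open>
  The part of the energy coming from pairs that split immediately after the prefix \<open>v\<close>, in one of the
  two orders.
\<close>

definition cross :: "nat \<Rightarrow> bool list \<Rightarrow> real \<times> real \<Rightarrow> real" where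
  "cross n v x = (\<Sum>w\<in>words n. \<Sum>w'\<in>words n. kern x (v @ True # w) (v @ False # w'))"

text \<open>
  The rectangle of parameters \<open>(\<beta>1, \<beta>2)\<close>.
\<close>

definition param_box :: "(real \<times> real) set" where
  "param_box = {b1..0.739} \<times> {b2..0.739}"

text \<open>
  The distance between the intervals containing the two first-level cylinders in the second coordinate.
\<close>

definition sep :: real where "sep = d - c * (d / (1 - c * d))"

lemma p01: "0 < p0" "0 < p1" "p0 + p1 = 1"
proof -
  show "0 < p0" "0 < p1" using c d b1 b2 S_gt_1 by (auto simp: p0_def p1_def)
  have "p0 + p1 = S / S"
    by (simp only: p0_def p1_def add_divide_distrib[symmetric] S_eq[symmetric])
  also have "S / S = 1" using S_gt_1 by simp
  finally show "p0 + p1 = 1" .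
qed

lemma prob_nonneg: "0 \<le> prob w"
  using wprod_pos[OF p01(1,2), of w] by (simp add: prob_def)

lemma prob_append: "prob (v @ w) = prob v * prob w"
  by (simp add: prob_def wprod_append)

lemma sum_prob: "(\<Sum>w\<in>words n. prob w) = 1"
  using p01(3) by (simp add: prob_def sum_words_wprod)

lemma sum_prob_Cons: "(\<Sum>w\<in>words n. prob (v @ i # w)) = prob v * prob [i]"
proof -
  have "prob (v @ i # w) = prob v * prob [i] * prob w" for w
    using prob_append[of v "i # w"] prob_append[of "[i]" w] by simp
  then show ?thesis by (simp add: sum_distrib_left[symmetric] sum_prob)
qed

lemma prob_le_1: "prob v \<le> 1"
  using wprod_mono[of p0 p1 1 1 v] p01 by (simp add: prob_def wprod_const)

text \<open>
  This relation between probabilities and contraction ratios makes the averaged energies summable.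
\<close>

lemma prob_eq: "prob v = wprod b1 (b1 * b2) v * wprod c (c * d) v powr (t - 1) / S ^ length v"
proof -
  have "prob v * S ^ length v = wprod (p0 * S) (p1 * S) v"
    by (simp add: prob_def wprod_const[symmetric] wprod_mult)
  also have "\<dots> = wprod b1 (b1 * b2) v * wprod c (c * d) v powr (t - 1)"
    using S_gt_1 c d by (simp add: p0_def p1_def wprod_powr wprod_mult)
  finally show ?thesis using S_gt_1 by (simp add: field_simps)
qed

lemma sep_pos: "0 < sep"
  unfolding sep_def using separation_constant_pos c d cd by blast

lemma dist_pt_ge_snd:
  "wprod c (c * d) v * sep \<le> dist (pt x (v @ True # u)) (pt x (v @ False # u'))"
proof -
  have "wprod c (c * d) v * sep \<le>
      wprod c (c * d) v * (cyl_point c d (True # u) - cyl_point c d (False # u'))"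
    unfolding sep_def using c d wprod_pos[of c "c * d" v]
    by (intro mult_left_mono cyl_point_separated) auto
  also have "\<dots> = cyl_point c d (v @ True # u) - cyl_point c d (v @ False # u')"
    by (simp only: cyl_point_append right_diff_distrib)
  also have "\<dots> \<le> dist (snd (pt x (v @ True # u))) (snd (pt x (v @ False # u')))"
    by (simp add: pt_def dist_real_def)
  also have "\<dots> \<le> dist (pt x (v @ True # u)) (pt x (v @ False # u'))"
    by (rule dist_snd_le)
  finally show ?thesis .
qed

lemma inj_on_pt: "inj_on (pt x) (words n)"
proof (rule inj_onI, rule ccontr)
  fix w w' assume w: "w \<in> words n" "w' \<in> words n" "pt x w = pt x w'" "w \<noteq> w'"
  then obtain v i u j u' where "i \<noteq> j" "w = v @ [i] @ u" "w' = v @ [j] @ u'"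
    using same_length_different[of w w'] by (metis (mono_tags, lifting) mem_Collect_eq words_def)
  then obtain u u' where "pt x (v @ True # u) = pt x (v @ False # u')"
    using w(3) by (cases i; cases j) (auto dest: sym)
  then show False
    using dist_pt_ge_snd[of v x u u'] sep_pos c d wprod_pos[of c "c * d" v]
    by (simp add: mult_le_0_iff)
qed

lemma dist_pt_ge_fst:
  assumes a: "a \<in> {b1..0.739}"
  obtains s0 where "\<And>s. s \<in> {b2..0.739} \<Longrightarrow>
    wprod b1 (b1 * b2) v * (0.06 * b1\<^sup>2 * b2\<^sup>2) * \<bar>s - s0\<bar> \<le>
      dist (pt (a, s) (v @ True # u)) (pt (a, s) (v @ False # u'))"
proof -
  obtain s0 where s0: "\<And>s. s \<in> {b2..0.739} \<Longrightarrow> 0.06 * b1\<^sup>2 * b2\<^sup>2 * \<bar>s - s0\<bar> \<le>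
      \<bar>cyl_point a s (True # u) - cyl_point a s (False # u')\<bar>"
    using cyl_point_transversal[of b1 a b2 u u'] a b1 b2 by auto
  show thesis
  proof (rule that)
    fix s assume s: "s \<in> {b2..0.739}"
    have "b1 * b2 \<le> a * s" using a s b1 b2 by (intro mult_mono) auto
    then have w: "0 \<le> wprod b1 (b1 * b2) v" "wprod b1 (b1 * b2) v \<le> wprod a (a * s) v"
      using wprod_mono[of b1 "b1 * b2" a "a * s" v] a b1 b2 by auto
    have "wprod b1 (b1 * b2) v * (0.06 * b1\<^sup>2 * b2\<^sup>2) * \<bar>s - s0\<bar> =
        wprod b1 (b1 * b2) v * (0.06 * b1\<^sup>2 * b2\<^sup>2 * \<bar>s - s0\<bar>)" by simp
    also have "\<dots> \<le> wprod a (a * s) v * \<bar>cyl_point a s (True # u) - cyl_point a s (False # u')\<bar>"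
      using s0[OF s] w by (intro mult_mono) auto
    also have "\<dots> = \<bar>wprod a (a * s) v * (cyl_point a s (True # u) - cyl_point a s (False # u'))\<bar>"
      using w by (simp add: abs_mult del: cyl_point.simps)
    also have "\<dots> = \<bar>cyl_point a s (v @ True # u) - cyl_point a s (v @ False # u')\<bar>"
      by (simp only: cyl_point_append right_diff_distrib add_diff_cancel_left)
    also have "\<dots> = dist (fst (pt (a, s) (v @ True # u))) (fst (pt (a, s) (v @ False # u')))"
      by (simp add: pt_def dist_real_def)
    also have "\<dots> \<le> dist (pt (a, s) (v @ True # u)) (pt (a, s) (v @ False # u'))"
      by (rule dist_fst_le)
    finally show "wprod b1 (b1 * b2) v * (0.06 * b1\<^sup>2 * b2\<^sup>2) * \<bar>s - s0\<bar> \<le>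
      dist (pt (a, s) (v @ True # u)) (pt (a, s) (v @ False # u'))" .
  qed
qed

lemma continuous_on_pt: "continuous_on UNIV (\<lambda>x. pt x w)"
proof -
  have "continuous_on UNIV (\<lambda>x :: real \<times> real. cyl_point (fst x) (snd x) w)"
  proof (induction w)
    case (Cons i w)
    then show ?case by (cases i) (auto intro!: continuous_on_add continuous_on_mult continuous_on_fst continuous_on_snd continuous_on_id)
  qed simp
  then show ?thesis unfolding pt_def by (intro continuous_on_Pair) auto
qed

lemma measurable_dist_pt [measurable]:
  "(\<lambda>x. dist (pt x w) (pt x w')) \<in> borel_measurable borel"
  by (intro borel_measurable_continuous_onI continuous_on_dist continuous_on_pt)

lemma measurable_kern [measurable]: "(\<lambda>x. kern x w w') \<in> borel_measurable borel"
  unfolding kern_def by measurable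

lemma measurable_energy [measurable]: "(\<lambda>x. energy n v x) \<in> borel_measurable borel"
  unfolding energy_def by measurable

lemma measurable_cross [measurable]: "(\<lambda>x. cross n v x) \<in> borel_measurable borel"
  unfolding cross_def by measurable

lemma param_box_sets [measurable]: "param_box \<in> sets borel"
  unfolding param_box_def by (intro borel_closed closed_Times) auto

lemma kern_nonneg: "0 \<le> kern x w w'"
  using prob_nonneg by (simp add: kern_def)

lemma energy_nonneg: "0 \<le> energy n v x"
  unfolding energy_def by (intro sum_nonneg kern_nonneg)

lemma cross_nonneg: "0 \<le> cross n v x"
  unfolding cross_def by (intro sum_nonneg kern_nonneg)

lemma kern_sym: "kern x w w' = kern x w' w"
  by (simp add: kern_def dist_commute)

lemma energy_Suc:
  "energy (Suc n) v x = energy n (v @ [False]) x + energy n (v @ [True]) x + 2 * cross n v x"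
proof -
  have "(\<Sum>w\<in>words n. \<Sum>w'\<in>words n. kern x (v @ False # w) (v @ True # w')) = cross n v x"
    unfolding cross_def by (subst sum.swap) (simp add: kern_sym)
  then show ?thesis
    by (simp add: energy_def sum_words_Suc sum.distrib) (simp add: cross_def)
qed

text \<open>
  The constant in the bound for averaged pair contributions; \<open>0.06 b1^2 b2^2\<close> is the transversality
  constant.
\<close>

definition cross_const :: real where
  "cross_const = 2 powr t * kernel_integral t * sep powr (1 - t) / (0.06 * b1\<^sup>2 * b2\<^sup>2)"

lemma cross_const_nonneg: "0 \<le> cross_const"
  using kernel_integral_nonneg[of t] b1 b2 by (simp add: cross_const_def)

text \<open>
  The parameter \<open>\<beta>2\<close> is integrated first, by transversality; the interval of values of \<open>\<beta>1\<close> has length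
  less than 1.
\<close>

lemma nn_integral_dist_pt:
  "(\<integral>\<^sup>+x. ennreal (dist (pt x (v @ True # u)) (pt x (v @ False # u')) powr (- t)) * indicator param_box x \<partial>lborel)
    \<le> ennreal (cross_const * wprod c (c * d) v powr (1 - t) / wprod b1 (b1 * b2) v)"
  (is "?I \<le> ennreal ?K")
proof -
  let ?f = "\<lambda>x. ennreal (dist (pt x (v @ True # u)) (pt x (v @ False # u')) powr (- t)) * indicator param_box x"
  define r \<rho> where "r = wprod c (c * d) v" and "\<rho> = wprod b1 (b1 * b2) v"
  have pos: "0 < r" "0 < \<rho>" using c d b1 b2 by (auto simp: r_def \<rho>_def intro!: wprod_pos)
  have K: "2 powr t * kernel_integral t * (r * sep) powr (1 - t) / (\<rho> * (0.06 * b1\<^sup>2 * b2\<^sup>2)) = ?K"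
    using pos sep_pos by (simp add: cross_const_def powr_mult r_def[symmetric] \<rho>_def[symmetric] field_simps)
  have inner: "(\<integral>\<^sup>+s. ?f (a, s) \<partial>lborel) \<le> ennreal ?K * indicator {b1..0.739} a" for a
  proof (cases "a \<in> {b1..0.739}")
    case True
    obtain s0 where s0: "\<And>s. s \<in> {b2..0.739} \<Longrightarrow> \<rho> * (0.06 * b1\<^sup>2 * b2\<^sup>2) * \<bar>s - s0\<bar> \<le>
        dist (pt (a, s) (v @ True # u)) (pt (a, s) (v @ False # u'))"
      using dist_pt_ge_fst[OF True, of v u u'] unfolding \<rho>_def by blast
    have "(\<integral>\<^sup>+s. ?f (a, s) \<partial>lborel) =
      (\<integral>\<^sup>+s. ennreal (dist (pt (a, s) (v @ True # u)) (pt (a, s) (v @ False # u')) powr (- t)) *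
        indicator {b2..0.739} s \<partial>lborel)"
      using True by (intro nn_integral_cong) (auto simp: param_box_def indicator_def)
    also have "\<dots> \<le> ennreal (2 powr t * kernel_integral t * (r * sep) powr (1 - t) / (\<rho> * (0.06 * b1\<^sup>2 * b2\<^sup>2)))"
    proof (rule nn_integral_transversal[OF t _ _ s0])
      show "0 < \<rho> * (0.06 * b1\<^sup>2 * b2\<^sup>2)" "0 < r * sep" using pos sep_pos b1 b2 by auto
    qed (auto simp: r_def intro: dist_pt_ge_snd)
    finally show ?thesis using True unfolding K by simp
  next
    case False
    then have "?f (a, s) = 0" for s by (auto simp: param_box_def indicator_def)
    then show ?thesis by (simp only: nn_integral_const mult_zero_left zero_le)
  qed
  have "?f \<in> borel_measurable (lborel \<Otimes>\<^sub>M lborel)"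
    unfolding lborel_prod by measurable
  then have "?I = (\<integral>\<^sup>+a. \<integral>\<^sup>+s. ?f (a, s) \<partial>lborel \<partial>lborel)"
    by (subst lborel_prod[symmetric], subst lborel.nn_integral_fst) auto
  also have "\<dots> \<le> (\<integral>\<^sup>+a. ennreal ?K * indicator {b1..0.739} a \<partial>lborel)"
    by (intro nn_integral_mono inner)
  also have "\<dots> = ennreal ?K * ennreal (0.739 - b1)"
    using b1 by (subst nn_integral_cmult_indicator) auto
  also have "\<dots> \<le> ennreal ?K * ennreal 1"
    using b1 by (intro mult_left_mono ennreal_leI) auto
  finally show ?thesis by simp
qed

lemma nn_integral_cross:
  "(\<integral>\<^sup>+x. ennreal (cross n v x) * indicator param_box x \<partial>lborel) \<le>
    ennreal (cross_const * (prob v * (1 / S) ^ length v))"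
proof -
  define K where "K = cross_const * wprod c (c * d) v powr (1 - t) / wprod b1 (b1 * b2) v"
  have pos: "0 < wprod c (c * d) v" "0 < wprod b1 (b1 * b2) v"
    using c d b1 b2 by (auto intro!: wprod_pos)
  have K: "0 \<le> K" using cross_const_nonneg pos by (simp add: K_def)
  let ?q = "\<lambda>w w'. prob (v @ True # w) * prob (v @ False # w')"
  let ?D = "\<lambda>x w w'. dist (pt x (v @ True # w)) (pt x (v @ False # w')) powr (- t)"
  have "ennreal (cross n v x) * indicator param_box x =
      (\<Sum>w\<in>words n. \<Sum>w'\<in>words n. ennreal (?q w w') * (ennreal (?D x w w') * indicator param_box x))" for x
  proof -
    have "ennreal (cross n v x) = (\<Sum>w\<in>words n. \<Sum>w'\<in>words n. ennreal (?q w w' * ?D x w w'))"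
      unfolding cross_def kern_def using prob_nonneg by (simp add: sum_nonneg)
    then show ?thesis using prob_nonneg by (simp add: ennreal_mult sum_distrib_right mult.assoc)
  qed
  then have "(\<integral>\<^sup>+x. ennreal (cross n v x) * indicator param_box x \<partial>lborel) =
      (\<Sum>w\<in>words n. \<Sum>w'\<in>words n. ennreal (?q w w') * (\<integral>\<^sup>+x. ennreal (?D x w w') * indicator param_box x \<partial>lborel))"
    by (simp add: nn_integral_sum nn_integral_cmult)
  also have "\<dots> \<le> (\<Sum>w\<in>words n. \<Sum>w'\<in>words n. ennreal (?q w w') * ennreal K)"
    unfolding K_def by (intro sum_mono mult_left_mono nn_integral_dist_pt) auto
  also have "\<dots> = ennreal (\<Sum>w\<in>words n. \<Sum>w'\<in>words n. ?q w w' * K)"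
    using K prob_nonneg by (simp add: ennreal_mult[symmetric] sum_nonneg)
  finally have int_le: "(\<integral>\<^sup>+x. ennreal (cross n v x) * indicator param_box x \<partial>lborel) \<le>
      ennreal (\<Sum>w\<in>words n. \<Sum>w'\<in>words n. ?q w w' * K)" .
  have "(\<Sum>w\<in>words n. \<Sum>w'\<in>words n. ?q w w' * K) =
      (\<Sum>w\<in>words n. prob (v @ True # w)) * (\<Sum>w'\<in>words n. prob (v @ False # w')) * K"
    by (simp only: sum_product sum_distrib_right[symmetric])
  also have "\<dots> = prob v * prob [True] * (prob v * prob [False]) * K"
    by (simp only: sum_prob_Cons)
  also have "prob v * prob [True] * (prob v * prob [False]) * K =
      prob [True] * prob [False] * (prob v * prob v * K)"
    by (simp add: mult_ac)
  also have "\<dots> \<le> 1 * (prob v * prob v * K)"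
    using prob_nonneg prob_le_1 K by (intro mult_right_mono mult_le_one) auto
  also have "1 * (prob v * prob v * K) = cross_const * (prob v * (1 / S) ^ length v)"
  proof -
    have "prob v * (wprod c (c * d) v powr (1 - t) / wprod b1 (b1 * b2) v) =
       (wprod c (c * d) v powr (t - 1) * wprod c (c * d) v powr (1 - t)) / S ^ length v"
      using pos by (simp add: prob_eq field_simps)
    also have "wprod c (c * d) v powr (t - 1) * wprod c (c * d) v powr (1 - t) = 1"
      using pos by (simp add: powr_add[symmetric])
    finally have eq: "prob v * (wprod c (c * d) v powr (1 - t) / wprod b1 (b1 * b2) v) = (1 / S) ^ length v"
      by (simp add: power_divide)
    have "1 * (prob v * prob v * K) = cross_const *
        (prob v * (prob v * (wprod c (c * d) v powr (1 - t) / wprod b1 (b1 * b2) v)))"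
      by (simp add: K_def)
    then show ?thesis unfolding eq .
  qed
  finally show ?thesis by (intro order_trans[OF int_le] ennreal_leI)
qed

text \<open>
  Passing from \<open>n\<close> to \<open>n + 1\<close> splits the pairs by their first letters. The two halves of equal first
  letters carry the probabilities of the prolonged prefixes, which add up to \<open>prob v\<close>, with a further
  factor \<open>1 / S\<close>; so the bounds sum up to a geometric series.
\<close>

lemma nn_integral_energy:
  "(\<integral>\<^sup>+x. ennreal (energy n v x) * indicator param_box x \<partial>lborel) \<le>
    ennreal (2 * cross_const / (1 - 1 / S) * (prob v * (1 / S) ^ length v))"
proof (induction n arbitrary: v)
  case 0
  have "energy 0 v x = 0" for x by (simp add: energy_def kern_def)
  then show ?case by simp
next
  case (Suc n)
  let ?L = "2 * cross_const / (1 - 1 / S)"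
  let ?Q = "prob v * (1 / S) ^ length v"
  have S: "0 < 1 - 1 / S" using S_gt_1 by simp
  have L: "0 \<le> ?L" using cross_const_nonneg S by simp
  have Q: "0 \<le> ?Q" using prob_nonneg S_gt_1 by simp
  have "(\<integral>\<^sup>+x. ennreal (energy (Suc n) v x) * indicator param_box x \<partial>lborel) =
    (\<integral>\<^sup>+x. ennreal (energy n (v @ [False]) x) * indicator param_box x +
       ennreal (energy n (v @ [True]) x) * indicator param_box x +
       2 * (ennreal (cross n v x) * indicator param_box x) \<partial>lborel)"
    using energy_nonneg cross_nonneg
    by (intro nn_integral_cong) (simp add: energy_Suc ennreal_plus ennreal_mult distrib_right mult.assoc)
  also have "\<dots> = (\<integral>\<^sup>+x. ennreal (energy n (v @ [False]) x) * indicator param_box x \<partial>lborel) +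
     (\<integral>\<^sup>+x. ennreal (energy n (v @ [True]) x) * indicator param_box x \<partial>lborel) +
     2 * (\<integral>\<^sup>+x. ennreal (cross n v x) * indicator param_box x \<partial>lborel)"
    by (simp add: nn_integral_add nn_integral_cmult)
  also have "\<dots> \<le> ennreal (?L * (prob (v @ [False]) * (1 / S) ^ length (v @ [False]))) +
     ennreal (?L * (prob (v @ [True]) * (1 / S) ^ length (v @ [True]))) +
     2 * ennreal (cross_const * ?Q)"
    by (intro add_mono mult_left_mono Suc.IH nn_integral_cross) auto
  also have "\<dots> = ennreal (?L * (prob (v @ [False]) * (1 / S) ^ length (v @ [False])) +
     ?L * (prob (v @ [True]) * (1 / S) ^ length (v @ [True])) + 2 * (cross_const * ?Q))"
    using L prob_nonneg S_gt_1 cross_const_nonneg Q by (simp add: ennreal_plus ennreal_mult)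
  also have "?L * (prob (v @ [False]) * (1 / S) ^ length (v @ [False])) +
     ?L * (prob (v @ [True]) * (1 / S) ^ length (v @ [True])) + 2 * (cross_const * ?Q) = ?L * ?Q"
  proof -
    have "prob (v @ [False]) + prob (v @ [True]) = prob v"
      using p01(3) by (simp add: prob_append distrib_left[symmetric]) (simp add: prob_def)
    moreover have "prob (v @ [False]) * (1 / S) ^ length (v @ [False]) +
        prob (v @ [True]) * (1 / S) ^ length (v @ [True]) =
        1 / S * ((prob (v @ [False]) + prob (v @ [True])) * (1 / S) ^ length v)"
      by (simp add: distrib_right add_divide_distrib)
    ultimately have "?L * (prob (v @ [False]) * (1 / S) ^ length (v @ [False])) +
        ?L * (prob (v @ [True]) * (1 / S) ^ length (v @ [True])) = ?L * (1 / S * ?Q)"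
      by (simp only: distrib_left[symmetric])
    moreover have "2 * cross_const = ?L * (1 - 1 / S)" using S by (metis less_irrefl nonzero_eq_divide_eq)
    then have "2 * (cross_const * ?Q) = ?L * (1 - 1 / S) * ?Q" by (simp only: mult.assoc[symmetric])
    moreover have "L * (1 / S * Q) + L * (1 - 1 / S) * Q = L * Q" for L Q :: real
      by (simp add: algebra_simps)
    ultimately show ?thesis by (simp only:)
  qed
  finally show ?case .
qed

lemma sum_prob_sq_tendsto: "(\<lambda>n. \<Sum>w\<in>words n. (prob w)\<^sup>2) \<longlonglongrightarrow> 0"
proof -
  have "(\<Sum>w\<in>words n. (prob w)\<^sup>2) = (p0 * p0 + p1 * p1) ^ n" for n
    by (simp add: power2_eq_square prob_def wprod_mult sum_words_wprod)
  moreover have "p0 * p0 + p1 * p1 < 1"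
  proof -
    have "p0 * p0 + p1 * p1 < p0 * 1 + p1 * 1"
      using p01 by (intro add_strict_mono mult_strict_left_mono) auto
    then show ?thesis using p01 by simp
  qed
  ultimately show ?thesis using p01 by (simp add: LIMSEQ_realpow_zero)
qed

lemma AE_energy_bounded:
  "AE x in lborel. x \<in> param_box \<longrightarrow> (\<exists>M. \<forall>n. \<exists>m\<ge>n. energy m [] x \<le> M)"
proof -
  let ?u = "\<lambda>n x. ennreal (energy n [] x) * indicator param_box x"
  let ?K = "2 * cross_const / (1 - 1 / S) * (prob [] * (1 / S) ^ length ([] :: bool list))"
  have "(\<integral>\<^sup>+x. liminf (\<lambda>n. ?u n x) \<partial>lborel) \<le> liminf (\<lambda>n. \<integral>\<^sup>+x. ?u n x \<partial>lborel)"
    by (rule nn_integral_liminf) measurable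
  also have "\<dots> \<le> liminf (\<lambda>n. ennreal ?K)"
    by (intro Liminf_mono always_eventually allI nn_integral_energy)
  also have "\<dots> = ennreal ?K" by (simp add: Liminf_const)
  finally have "(\<integral>\<^sup>+x. liminf (\<lambda>n. ?u n x) \<partial>lborel) \<noteq> \<infinity>"
    by (auto simp: top_unique)
  then have "AE x in lborel. liminf (\<lambda>n. ?u n x) \<noteq> \<infinity>"
    by (intro nn_integral_PInf_AE) measurable
  then show ?thesis
  proof eventually_elim
    case (elim x)
    show ?case
    proof
      assume x: "x \<in> param_box"
      obtain M where M: "0 \<le> M" "liminf (\<lambda>n. ?u n x) = ennreal M"
        using elim by (cases "liminf (\<lambda>n. ?u n x)") auto
      have "\<exists>m\<ge>n. energy m [] x \<le> M + 1" for n
      proof -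
        have "(INF m\<in>{n..}. ?u m x) \<le> liminf (\<lambda>n. ?u n x)"
          unfolding liminf_SUP_INF by (intro SUP_upper) auto
        also have "\<dots> < ennreal (M + 1)" using M by (simp add: ennreal_lessI)
        finally obtain m where "m \<ge> n" "?u m x < ennreal (M + 1)"
          by (auto simp: INF_less_iff)
        then have "ennreal (energy m [] x) < ennreal (M + 1)" using x by (simp del: ennreal_plus)
        then have "energy m [] x < M + 1" by (subst (asm) ennreal_less_iff) (rule energy_nonneg)
        then show ?thesis using \<open>m \<ge> n\<close> less_imp_le by blast
      qed
      then show "\<exists>M. \<forall>n. \<exists>m\<ge>n. energy m [] x \<le> M" by blast
    qed
  qed
qed

text \<open>
  The sum of the squared probabilities of the words of length \<open>m\<close> tends to 0, so the criterion applies
  with a suitable \<open>m\<close> among the infinitely many whose energy is bounded by \<open>M\<close>.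
\<close>

lemma AE_hausdorff_measure_pos:
  "AE x in lborel. x \<in> param_box \<longrightarrow>
    (\<forall>s\<in>{0..t}. hausdorff_measure s (attractor (fst x) (snd x) c d) \<noteq> 0)"
  using AE_energy_bounded
proof eventually_elim
  case (elim x)
  show ?case
  proof (intro impI ballI)
    fix s assume x: "x \<in> param_box" and s: "s \<in> {0..t}"
    obtain M where M: "\<And>n. \<exists>m\<ge>n. energy m [] x \<le> M" using elim x by blast
    have x01: "fst x \<in> {0<..<1}" "snd x \<in> {0<..<1}" using x b1 b2 by (auto simp: param_box_def)
    show "hausdorff_measure s (attractor (fst x) (snd x) c d) \<noteq> 0"
    proof (rule hausdorff_measure_pos_of_discrete_energy[where t = t and M = M])
      show "compact (attractor (fst x) (snd x) c d)"
        using x01 c d by (intro compact_attractor) auto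
      show "0 \<le> s" "s \<le> t" "0 < t" using s t by auto
      fix \<eta> :: real assume "0 < \<eta>"
      then have "eventually (\<lambda>n. (\<Sum>w\<in>words n. (prob w)\<^sup>2) < \<eta>) sequentially"
        using sum_prob_sq_tendsto by (intro order_tendstoD(2)) auto
      then obtain n where n: "\<And>m. m \<ge> n \<Longrightarrow> (\<Sum>w\<in>words m. (prob w)\<^sup>2) < \<eta>"
        by (auto simp: eventually_sequentially)
      obtain m where m: "m \<ge> n" "energy m [] x \<le> M" using M by blast
      have "(\<Sum>w\<in>words m. \<Sum>w'\<in>words m. if w = w' then 0
          else prob w * prob w' * dist (pt x w) (pt x w') powr (- t)) \<le> M"
        using m(2) by (simp add: energy_def kern_def)
      moreover have "pt x ` words m \<subseteq> attractor (fst x) (snd x) c d"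
        using cyl_point_in_attractor[of "fst x" "snd x" c d] x01 c d by (auto simp: pt_def)
      ultimately show "\<exists>(W :: bool list set) P p. finite W \<and> P ` W \<subseteq> attractor (fst x) (snd x) c d \<and>
         inj_on P W \<and> (\<forall>w\<in>W. 0 \<le> p w) \<and> sum p W = 1 \<and> (\<Sum>w\<in>W. (p w)\<^sup>2) \<le> \<eta> \<and>
         (\<Sum>w\<in>W. \<Sum>w'\<in>W. if w = w' then 0 else p w * p w' * dist (P w) (P w') powr (- t)) \<le> M"
        using inj_on_pt prob_nonneg sum_prob n[OF m(1)]
        by (intro exI[of _ "words m"] exI[of _ "pt x"] exI[of _ prob]) (auto simp: less_imp_le)
    qed
  qed
qed

end

section \<open>The dimension\<close>

lemma dimension_equation_solution:
  fixes \<beta>1 \<beta>2 \<tau>1 \<tau>2 :: real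
  assumes \<tau>: "0 < \<tau>1" "\<tau>1 < 1" "0 < \<tau>2" "\<tau>2 < 1" and \<beta>: "0 < \<beta>1" "0 < \<beta>2"
    and gt: "1 < \<beta>1 + \<beta>1 * \<beta>2"
  obtains d where "1 < d" "\<beta>1 * \<tau>1 powr (d - 1) + \<beta>1 * \<beta>2 * (\<tau>1 * \<tau>2) powr (d - 1) = 1"
    "\<And>t. t < d \<Longrightarrow> 1 < \<beta>1 * \<tau>1 powr (t - 1) + \<beta>1 * \<beta>2 * (\<tau>1 * \<tau>2) powr (t - 1)"
    "\<And>t. d < t \<Longrightarrow> \<beta>1 * \<tau>1 powr (t - 1) + \<beta>1 * \<beta>2 * (\<tau>1 * \<tau>2) powr (t - 1) < 1"
proof -
  define \<phi> where "\<phi> d = \<beta>1 * \<tau>1 powr (d - 1) + \<beta>1 * \<beta>2 * (\<tau>1 * \<tau>2) powr (d - 1)" for d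
  have \<tau>12: "0 < \<tau>1 * \<tau>2" "\<tau>1 * \<tau>2 < 1"
    using \<tau> mult_strict_mono[of \<tau>1 1 \<tau>2 1] by auto
  have powr_anti: "q powr t < q powr s" if "0 < q" "q < 1" "s < t" for q s t :: real
    using that by (simp add: powr_def)
  have anti: "\<phi> t < \<phi> s" if "s < t" for s t
    unfolding \<phi>_def using that \<beta> \<tau> \<tau>12
    by (intro add_strict_mono mult_strict_left_mono powr_anti) auto
  have powr_lim: "((\<lambda>d. q powr (d - 1)) \<longlongrightarrow> 0) at_top" if "0 < q" "q < 1" for q :: real
    using that by real_asymp
  have "(\<phi> \<longlongrightarrow> \<beta>1 * 0 + \<beta>1 * \<beta>2 * 0) at_top"
    unfolding \<phi>_def by (intro tendsto_intros powr_lim \<tau> \<tau>12)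
  then have "eventually (\<lambda>d. \<phi> d < 1) at_top" by (intro order_tendstoD(2)) auto
  then have "eventually (\<lambda>d. \<phi> d < 1 \<and> 1 < d) at_top"
    using eventually_gt_at_top[of 1] by eventually_elim auto
  then obtain D where D: "\<phi> D < 1" "1 < D" by (auto simp: eventually_at_top_linorder)
  have \<phi>1: "1 < \<phi> 1" using gt \<tau> by (simp add: \<phi>_def)
  have "continuous_on {1..D} \<phi>"
    unfolding \<phi>_def using \<tau> by (auto intro!: continuous_intros)
  then obtain d where d: "1 \<le> d" "\<phi> d = 1" using IVT2'[of \<phi> D 1 1] D \<phi>1 by auto
  then have "d \<noteq> 1" using \<phi>1 by auto
  then show thesis
    using that[of d, folded \<phi>_def] d anti[of _ d] anti[of d] by auto
qed

lemma sum_powr_less_1: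
  fixes c d t :: real
  assumes "0 < c" "c < 1" "0 < d" "d < 1" "c + c * d < 1" "1 \<le> t"
  shows "c powr t + (c * d) powr t < 1"
proof -
  have "q powr t \<le> q" if "0 < q" "q \<le> 1" for q :: real
    using powr_mono'[of 1 t q] that assms by simp
  moreover have "c * d \<le> 1" using assms mult_mono[of c 1 d 1] by auto
  ultimately have "c powr t + (c * d) powr t \<le> c + c * d" using assms by (intro add_mono) auto
  then show ?thesis using assms by simp
qed

lemma hausdorff_dim_eqI:
  assumes "0 \<le> d"
    and upper: "\<And>t. d < t \<Longrightarrow> hausdorff_measure t E = 0"
    and lower: "\<And>s. 0 \<le> s \<Longrightarrow> s < d \<Longrightarrow> hausdorff_measure s E \<noteq> 0"
  shows "hausdorff_dim E = ereal d"
  unfolding hausdorff_dim_def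
proof (rule antisym)
  show "Inf (ereal ` {t. 0 \<le> t \<and> hausdorff_measure t E = 0}) \<le> ereal d"
  proof (rule ereal_le_epsilon2)
    fix e :: real assume "0 < e"
    then have "ereal (d + e) \<in> ereal ` {t. 0 \<le> t \<and> hausdorff_measure t E = 0}"
      using assms(1) upper[of "d + e"] by auto
    then show "Inf (ereal ` {t. 0 \<le> t \<and> hausdorff_measure t E = 0}) \<le> ereal d + ereal e"
      by (simp add: Inf_lower)
  qed
  show "ereal d \<le> Inf (ereal ` {t. 0 \<le> t \<and> hausdorff_measure t E = 0})"
    using lower by (intro Inf_greatest) (auto intro: leI)
qed

text \<open>
  Shrinking both parameters by \<open>q = 1 / sqrt P\<close>, where \<open>P\<close> is the value of the sum, lowers it by the
  factor \<open>q^2\<close> at most, hence to 1 at the least; so larger rational parameters keep it above 1.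
\<close>

lemma rational_lower_corner:
  fixes \<beta>1 \<beta>2 T1 T2 :: real
  assumes "0 < \<beta>1" "0 < \<beta>2" "0 < T1" "0 < T2" "1 < \<beta>1 * T1 + \<beta>1 * \<beta>2 * T2"
  obtains b1 b2 :: rat where "0 < real_of_rat b1" "real_of_rat b1 < \<beta>1"
    "0 < real_of_rat b2" "real_of_rat b2 < \<beta>2"
    "1 < real_of_rat b1 * T1 + real_of_rat b1 * real_of_rat b2 * T2"
proof -
  define P where "P = \<beta>1 * T1 + \<beta>1 * \<beta>2 * T2"
  define q where "q = 1 / sqrt P"
  have P: "1 < P" using assms by (simp add: P_def)
  then have "1 < sqrt P" by simp
  then have q: "0 < q" "q < 1" by (auto simp: q_def)
  have q2: "q\<^sup>2 * P = 1" using P by (simp add: q_def power_divide)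
  have "q * \<beta>1 < \<beta>1" "q * \<beta>2 < \<beta>2" using q assms by auto
  then obtain b1 b2 where b: "q * \<beta>1 < real_of_rat b1" "real_of_rat b1 < \<beta>1"
    "q * \<beta>2 < real_of_rat b2" "real_of_rat b2 < \<beta>2"
    using of_rat_dense by meson
  have pos: "0 < q * \<beta>1" "0 < q * \<beta>2" using q assms by auto
  have b_pos: "0 < real_of_rat b1" "0 < real_of_rat b2"
    using less_trans[OF pos(1) b(1)] less_trans[OF pos(2) b(3)] .
  have "q * q * (\<beta>1 * T1) \<le> q * 1 * (\<beta>1 * T1)"
    using q assms by (intro mult_right_mono mult_left_mono) auto
  then have "1 \<le> q * \<beta>1 * T1 + (q * \<beta>1) * (q * \<beta>2) * T2"
    using q2 by (simp add: P_def power2_eq_square algebra_simps)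
  also have "\<dots> < real_of_rat b1 * T1 + real_of_rat b1 * real_of_rat b2 * T2"
    using b b_pos pos assms by (intro add_strict_mono mult_strict_right_mono mult_strict_mono) auto
  finally show thesis
    using that[OF b_pos(1) b(2) b_pos(2) b(4)] by blast
qed

text \<open>
  The exceptional null set is the union of those of the countably many rational choices of the exponent
  and of the corner, so it does not depend on \<open>t\<close> and \<open>s\<close>.
\<close>

lemma AE_hausdorff_measure_attractor_pos:
  fixes \<tau>1 \<tau>2 :: real
  assumes \<tau>: "0 < \<tau>1" "\<tau>1 < 1" "0 < \<tau>2" "\<tau>2 < 1" "\<tau>1 + \<tau>1 * \<tau>2 < 1"
  shows "AE x in lborel. \<forall>t s. 1 < t \<and> 0 \<le> s \<and> s < t \<and>
      0 < fst x \<and> fst x < 0.739 \<and> 0 < snd x \<and> snd x < 0.739 \<and>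
      1 < fst x * \<tau>1 powr (t - 1) + fst x * snd x * (\<tau>1 * \<tau>2) powr (t - 1) \<longrightarrow>
      hausdorff_measure s (attractor (fst x) (snd x) \<tau>1 \<tau>2) \<noteq> 0"
proof -
  have "AE x in lborel. \<forall>q :: rat \<times> rat \<times> rat. case q of (t, b1, b2) \<Rightarrow>
     1 < real_of_rat t \<and> 0 < real_of_rat b1 \<and> real_of_rat b1 < 0.739 \<and>
     0 < real_of_rat b2 \<and> real_of_rat b2 < 0.739 \<and>
     1 < real_of_rat b1 * \<tau>1 powr (real_of_rat t - 1) +
       real_of_rat b1 * real_of_rat b2 * (\<tau>1 * \<tau>2) powr (real_of_rat t - 1) \<longrightarrow>
     x \<in> {real_of_rat b1..0.739} \<times> {real_of_rat b2..0.739} \<longrightarrow>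
     (\<forall>s\<in>{0..real_of_rat t}. hausdorff_measure s (attractor (fst x) (snd x) \<tau>1 \<tau>2) \<noteq> 0)"
    unfolding AE_all_countable
  proof (intro allI, clarify, goal_cases)
    case (1 t b1 b2)
    show ?case
    proof (cases "1 < real_of_rat t \<and> 0 < real_of_rat b1 \<and> real_of_rat b1 < (0.739 :: real) \<and>
       0 < real_of_rat b2 \<and> real_of_rat b2 < (0.739 :: real) \<and>
       1 < real_of_rat b1 * \<tau>1 powr (real_of_rat t - 1) +
         real_of_rat b1 * real_of_rat b2 * (\<tau>1 * \<tau>2) powr (real_of_rat t - 1)")
      case True
      interpret energy_estimate \<tau>1 \<tau>2 "real_of_rat t" "real_of_rat b1" "real_of_rat b2"
        "real_of_rat b1 * \<tau>1 powr (real_of_rat t - 1) +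
         real_of_rat b1 * real_of_rat b2 * (\<tau>1 * \<tau>2) powr (real_of_rat t - 1)"
        by standard (use True \<tau> in simp_all)
      show ?thesis
        using AE_hausdorff_measure_pos unfolding param_box_def by eventually_elim auto
    next
      case False
      then show ?thesis by (intro AE_I2) auto
    qed
  qed
  then show ?thesis
  proof eventually_elim
    case (elim x)
    show ?case
    proof (intro allI impI, elim conjE)
      fix t s :: real
      assume t: "1 < t" and s: "0 \<le> s" "s < t" and x: "0 < fst x" "fst x < 0.739" "0 < snd x" "snd x < 0.739"
        and gt: "1 < fst x * \<tau>1 powr (t - 1) + fst x * snd x * (\<tau>1 * \<tau>2) powr (t - 1)"
      obtain r :: rat where r: "max 1 s < real_of_rat r" "real_of_rat r < t"
        using of_rat_dense[of "max 1 s" t] t s by auto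
      have "\<tau>1 * \<tau>2 \<le> 1" using \<tau> mult_mono[of \<tau>1 1 \<tau>2 1] by auto
      then have "fst x * \<tau>1 powr (t - 1) + fst x * snd x * (\<tau>1 * \<tau>2) powr (t - 1) \<le>
          fst x * \<tau>1 powr (real_of_rat r - 1) + fst x * snd x * (\<tau>1 * \<tau>2) powr (real_of_rat r - 1)"
        using \<tau> x r by (intro add_mono mult_left_mono powr_mono') auto
      with gt have "1 < fst x * \<tau>1 powr (real_of_rat r - 1) +
          fst x * snd x * (\<tau>1 * \<tau>2) powr (real_of_rat r - 1)" by linarith
      then obtain b1 b2 where "0 < real_of_rat b1" "real_of_rat b1 < fst x"
        "0 < real_of_rat b2" "real_of_rat b2 < snd x"
        "1 < real_of_rat b1 * \<tau>1 powr (real_of_rat r - 1) +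
          real_of_rat b1 * real_of_rat b2 * (\<tau>1 * \<tau>2) powr (real_of_rat r - 1)"
        using rational_lower_corner[of "fst x" "snd x"] x \<tau> by (metis mult_pos_pos powr_gt_zero less_irrefl)
      then show "hausdorff_measure s (attractor (fst x) (snd x) \<tau>1 \<tau>2) \<noteq> 0"
        using elim[rule_format, of "(r, b1, b2)"] r x s by (cases x) auto
    qed
  qed
qed

theorem theorem3p3:
  fixes \<tau>1 \<tau>2 :: real
  assumes "\<tau>1 \<in> {0<..<1}" and "\<tau>2 \<in> {0<..<1}" and "\<tau>1 + \<tau>1 * \<tau>2 < 1"
  shows "AE (\<beta>1, \<beta>2) in (lebesgue :: (real \<times> real) measure).
           \<beta>1 \<in> {0<..<0.739} \<and> \<beta>2 \<in> {0<..<0.739} \<and> \<beta>1 + \<beta>1 * \<beta>2 > 1 \<longrightarrow>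
           (\<exists>d::real. d > 1 \<and>
              \<beta>1 * \<tau>1 powr (d - 1) + \<beta>1 * \<beta>2 * (\<tau>1 * \<tau>2) powr (d - 1) = 1 \<and>
              (\<forall>d'>1. \<beta>1 * \<tau>1 powr (d' - 1) + \<beta>1 * \<beta>2 * (\<tau>1 * \<tau>2) powr (d' - 1) = 1
                 \<longrightarrow> d' = d) \<and>
              hausdorff_dim
                ((\<lambda>s. (coding_map \<beta>1 \<beta>2 s, coding_map \<tau>1 \<tau>2 s)) ` fibonacci_subshift) = ereal d)"
proof -
  have \<tau>: "0 < \<tau>1" "\<tau>1 < 1" "0 < \<tau>2" "\<tau>2 < 1" using assms by auto
  show ?thesis
    using AE_completion[OF AE_hausdorff_measure_attractor_pos[OF \<tau> assms(3)]]
  proof eventually_elim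
    case (elim x)
    obtain \<beta>1 \<beta>2 where x: "x = (\<beta>1, \<beta>2)" by (cases x)
    show ?case unfolding x prod.case
    proof (intro impI, elim conjE)
      assume \<beta>_mem: "\<beta>1 \<in> {0<..<0.739}" "\<beta>2 \<in> {0<..<0.739}" and gt: "1 < \<beta>1 + \<beta>1 * \<beta>2"
      have \<beta>: "0 < \<beta>1" "\<beta>1 < 0.739" "0 < \<beta>2" "\<beta>2 < 0.739" using \<beta>_mem by auto
      obtain d where d: "1 < d"
        "\<beta>1 * \<tau>1 powr (d - 1) + \<beta>1 * \<beta>2 * (\<tau>1 * \<tau>2) powr (d - 1) = 1"
        "\<And>t. t < d \<Longrightarrow> 1 < \<beta>1 * \<tau>1 powr (t - 1) + \<beta>1 * \<beta>2 * (\<tau>1 * \<tau>2) powr (t - 1)"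
        "\<And>t. d < t \<Longrightarrow> \<beta>1 * \<tau>1 powr (t - 1) + \<beta>1 * \<beta>2 * (\<tau>1 * \<tau>2) powr (t - 1) < 1"
        using dimension_equation_solution[OF \<tau> \<beta>(1,3) gt] by blast
      have unique: "d' = d" if "\<beta>1 * \<tau>1 powr (d' - 1) + \<beta>1 * \<beta>2 * (\<tau>1 * \<tau>2) powr (d' - 1) = 1" for d'
        using d(3)[of d'] d(4)[of d'] that by (cases d' d rule: linorder_cases) auto
      have "hausdorff_dim (attractor \<beta>1 \<beta>2 \<tau>1 \<tau>2) = ereal d"
      proof (rule hausdorff_dim_eqI)
        show "hausdorff_measure t (attractor \<beta>1 \<beta>2 \<tau>1 \<tau>2) = 0" if "d < t" for t
          using that \<beta> \<tau> d(1) assms(3)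
          by (intro hausdorff_measure_attractor_eq_0 d(4) sum_powr_less_1) auto
        show "hausdorff_measure s (attractor \<beta>1 \<beta>2 \<tau>1 \<tau>2) \<noteq> 0" if s: "0 \<le> s" "s < d" for s
        proof -
          obtain t where "max 1 s < t" "t < d" using dense[of "max 1 s" d] d(1) s by auto
          then show ?thesis using elim[rule_format, of t s] s \<beta> d(3)[of t] by (auto simp: x)
        qed
      qed (use d(1) in simp)
      then show "\<exists>d>1. \<beta>1 * \<tau>1 powr (d - 1) + \<beta>1 * \<beta>2 * (\<tau>1 * \<tau>2) powr (d - 1) = 1 \<and>
          (\<forall>d'>1. \<beta>1 * \<tau>1 powr (d' - 1) + \<beta>1 * \<beta>2 * (\<tau>1 * \<tau>2) powr (d' - 1) = 1 \<longrightarrow> d' = d) \<and>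
          hausdorff_dim ((\<lambda>s. (coding_map \<beta>1 \<beta>2 s, coding_map \<tau>1 \<tau>2 s)) ` fibonacci_subshift) = ereal d"
        using d(1,2) unique unfolding attractor_def by blast
    qed
  qed
qed

end
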